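(* Let $r\ge 2$ be a fixed integer. Assume that the $abc$ conjecture for the number field $\mathbb{Q}(\sqrt{2})$ is true. Then $$\Big|\Big\{\text{odd primes } p\le x:\ p\equiv \pm 1 \pmod r,\ B_{p-\left(\frac{8}{p}\right)}\not\equiv 0 \pmod{p^2}\Big\}\Big| \gg_{\alpha,r} \log x ,$$ that is, there exist constants $c>0$ and $x_0$, depending only on $\alpha=3+2\sqrt2$ and $r$, such that for all real $x\ge x_0$ the left-hand side is at least $c\log x$.
   Context: The balancing numbers $(B_n)_{n\ge 0}$ are defined by $B_0=0$, $B_1=1$, $B_{n+1}=6B_n-B_{n-1}$ for $n\ge 1$. Equivalently $B_n=(\alpha^n-\beta^n)/(\alpha-\beta)$ with $\alpha=3+2\sqrt2$, $\beta=3-2\sqrt2$. For an odd prime $p$, $\left(\frac{8}{p}\right)$ is the Legendre symbol. An odd prime $p$ with $B_{p-\left(\frac{8}{p}\right)}\not\equiv 0\pmod {p^2}$ is called a balancing non-Wieferich prime. The condition $p\equiv\pm1\pmod r$ means $p\equiv 1$ or $p\equiv -1\pmod r$. The $abc$ conjecture for a number field $K$ (used here with $K=\mathbb{Q}(\sqrt2)$): Let $K^*=K\setminus\{0\}$, let $\mathcal{O}_K$ be the ring of integers, and let $V_K$ be the set of places of $K$ (finite and infinite). For a finite place $\upsilon$ given by a prime ideal $\mathfrak p$ of $\mathcal{O}_K$ with valuation $\upsilon_{\mathfrak p}$, put $\|x\|_\upsilon=N_{K/\mathbb{Q}}(\mathfrak p)^{-\upsilon_{\mathfrak p}(x)}$,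 where $N_{K/\mathbb{Q}}$ is the absolute norm. For an infinite place $\upsilon$ given by an embedding $\rho:K\to\mathbb{C}$ (up to complex conjugation), put $\|x\|_\upsilon=|\rho(x)|^e$ with $e=1$ if $\rho$ is real and $e=2$ if $\rho$ is complex. For $a,b,c\in K^*$ define $$H_K(a,b,c)=\prod_{\upsilon\in V_K}\max(\|a\|_\upsilon,\|b\|_\upsilon,\|c\|_\upsilon),\qquad \mathrm{rad}_K(a,b,c)=\prod_{\mathfrak p\in I_K(a,b,c)}N_{K/\mathbb{Q}}(\mathfrak p)^{\upsilon_{\mathfrak p}(p)},$$ where $I_K(a,b,c)$ is the set of prime ideals $\mathfrak p$ of $\mathcal{O}_K$ for which $\|a\|_{\upsilon},\|b\|_{\upsilon},\|c\|_{\upsilon}$ (at the place $\upsilon$ of $\mathfrak p$) are not all equal, and $p$ is the rational prime with $p\mathbb{Z}=\mathfrak p\cap\mathbb{Z}$. The conjecture asserts that for every $\varepsilon>0$ there is a constant $C_{K,\varepsilon}>0$ such that $H_K(a,b,c)\le C_{K,\varepsilon}\,(\mathrm{rad}_K(a,b,c))^{1+\varepsilon}$ for all $a,b,c\in K^*$ with $a+b+c=0$. *)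

theory Defs
  imports
    Complex_Main
    "HOL-Library.FuncSet"
    "HOL-Computational_Algebra.Computational_Algebra"
    "HOL-Number_Theory.Number_Theory"
    "HOL-Algebra.Ideal_Product"
    "HOL-Algebra.QuotRing"
    "HOL-Algebra.Generated_Fields"
    "HOL-Algebra.Algebraic_Closure_Type"
begin

fun balancing :: "nat \<Rightarrow> int" where
  "balancing 0 = 0"
| "balancing (Suc 0) = 1"
| "balancing (Suc (Suc n)) = 6 * balancing (Suc n) - balancing n"

definition balancing_non_wieferich :: "nat \<Rightarrow> bool" where
  "balancing_non_wieferich p \<longleftrightarrow> Factorial_Ring.prime p \<and> odd p \<and>
     \<not> [balancing (nat (int p - Legendre 8 (int p))) = 0] (mod (int p)\<^sup>2)"


text \<open>
  A number field is given as a subfield \<open>K\<close> of the complex numbers of finite degree over the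
  rationals.  The definitions below are meant for such \<open>K\<close> only.
\<close>

abbreviation complex_field :: "complex ring" where
  "complex_field \<equiv> ring_of_type_algebra"

abbreviation subring_of :: "complex set \<Rightarrow> complex ring" where
  "subring_of A \<equiv> complex_field\<lparr>carrier := A\<rparr>"

definition integers_of :: "complex set \<Rightarrow> complex set" where
  "integers_of K = {x \<in> K. algebraic_int x}"

abbreviation int_ring :: "complex set \<Rightarrow> complex ring" where
  "int_ring K \<equiv> subring_of (integers_of K)"

text \<open>As usual for the places of a number field, prime ideals are understood to be nonzero.\<close>

definition prime_ideals :: "complex set \<Rightarrow> complex set set" where
  "prime_ideals K = {P. primeideal P (int_ring K) \<and> P \<noteq> {0}}"

definition abs_norm :: "complex set \<Rightarrow> complex set \<Rightarrow> nat" where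
  "abs_norm K P = card (carrier (int_ring K Quot P))"

text \<open>
  The valuation of a nonzero integer is the largest exponent \<open>n\<close> such that it lies in the ideal
  power \<open>P\<^sup>n\<close> (the power is taken in the monoid of ideals, with \<open>P\<^sup>0\<close> the whole ring); it is
  extended to quotients of integers by additivity.
\<close>

definition int_valuation :: "complex set \<Rightarrow> complex set \<Rightarrow> complex \<Rightarrow> nat" where
  "int_valuation K P a = (GREATEST n::nat. a \<in> P [^]\<^bsub>ideals_set (int_ring K)\<^esub> n)"

definition valuation :: "complex set \<Rightarrow> complex set \<Rightarrow> complex \<Rightarrow> int" where
  "valuation K P x = (THE k. \<exists>a \<in> integers_of K - {0}. \<exists>b \<in> integers_of K - {0}.
     x = a / b \<and> k = int (int_valuation K P a) - int (int_valuation K P b))"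

text \<open>
  Embeddings are made extensional so that they are determined by their values on \<open>K\<close>.
  An infinite place is the class of an embedding up to complex conjugation.
\<close>

definition embeddings :: "complex set \<Rightarrow> (complex \<Rightarrow> complex) set" where
  "embeddings K = ring_hom (subring_of K) complex_field \<inter> extensional K"

definition conj_embedding :: "complex set \<Rightarrow> (complex \<Rightarrow> complex) \<Rightarrow> complex \<Rightarrow> complex" where
  "conj_embedding K \<rho> = (\<lambda>x\<in>K. cnj (\<rho> x))"

datatype place = Finite_Place "complex set" | Infinite_Place "(complex \<Rightarrow> complex) set"

definition places :: "complex set \<Rightarrow> place set" where
  "places K = Finite_Place ` prime_ideals K \<union>
     (\<lambda>\<rho>. Infinite_Place {\<rho>, conj_embedding K \<rho>}) ` embeddings K"

fun place_norm :: "complex set \<Rightarrow> place \<Rightarrow> complex \<Rightarrow> real" where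
  "place_norm K (Finite_Place P) x = real (abs_norm K P) powi (- valuation K P x)"
| "place_norm K (Infinite_Place w) x =
     (let \<rho> = (SOME \<rho>. \<rho> \<in> w) in cmod (\<rho> x) ^ (if \<rho> ` K \<subseteq> \<real> then 1 else 2))"

text \<open>
  All but finitely many factors of the height are \<open>1\<close>; the library product over an infinite index
  set is \<open>1\<close> by convention, so the product is restricted to the places with a nontrivial factor.
\<close>

definition height :: "complex set \<Rightarrow> complex \<Rightarrow> complex \<Rightarrow> complex \<Rightarrow> real" where
  "height K a b c =
     (let m = (\<lambda>v. Max {place_norm K v a, place_norm K v b, place_norm K v c})
      in \<Prod>v\<in>{v \<in> places K. m v \<noteq> 1}. m v)"

definition radical_primes :: "complex set \<Rightarrow> complex \<Rightarrow> complex \<Rightarrow> complex \<Rightarrow> complex set set" where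
  "radical_primes K a b c = {P \<in> prime_ideals K.
     \<not> (place_norm K (Finite_Place P) a = place_norm K (Finite_Place P) b \<and>
        place_norm K (Finite_Place P) b = place_norm K (Finite_Place P) c)}"

definition residue_char :: "complex set \<Rightarrow> nat" where
  "residue_char P = (THE p. Factorial_Ring.prime p \<and> {z::int. of_int z \<in> P} = {z. int p dvd z})"

definition radical :: "complex set \<Rightarrow> complex \<Rightarrow> complex \<Rightarrow> complex \<Rightarrow> real" where
  "radical K a b c = (\<Prod>P\<in>radical_primes K a b c.
     real (abs_norm K P) powi valuation K P (of_nat (residue_char P)))"

definition abc_conjecture :: "complex set \<Rightarrow> bool" where
  "abc_conjecture K \<longleftrightarrow> (\<forall>\<epsilon>::real. \<epsilon> > 0 \<longrightarrow> (\<exists>C::real. C > 0 \<and>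
     (\<forall>a \<in> K - {0}. \<forall>b \<in> K - {0}. \<forall>c \<in> K - {0}. a + b + c = 0 \<longrightarrow>
        height K a b c \<le> C * radical K a b c powr (1 + \<epsilon>))))"

text \<open>The field generated by the square root of 2 contains the rationals automatically.\<close>

definition Q_sqrt2 :: "complex set" where
  "Q_sqrt2 = generate_field complex_field {complex_of_real (sqrt 2)}"

end

theory Submission
  imports Defs
begin

text \<open>
  Applied to \<open>\<alpha>\<^sup>n - \<beta>\<^sup>n = 4\<surd>2 B\<^sub>n\<close>, whose height is \<open>\<alpha>\<^sup>2\<^sup>n\<close>, the abc conjecture shows that the
  product of the primes dividing \<open>B\<^sub>n\<close> exactly once is at least \<open>\<alpha>\<close> to the power \<open>(1 - o(1)) n\<close>.
  Such an odd prime \<open>p\<close> is non-Wieferich, because its rank of apparition \<open>d\<close> divides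
  \<open>p - (8/p)\<close> with a cofactor \<open>m\<close> prime to \<open>p\<close>, and \<open>B(dm)\<close> is \<open>B(d)\<close> times a unit modulo \<open>p\<^sup>2\<close>; if moreover \<open>r\<close> divides \<open>d\<close>, then
  \<open>p \<equiv> \<plusminus>1 (mod r)\<close>.

  Take \<open>n = Rk\<close> with \<open>R = r\<close> to the power \<open>M = r + 4\<close>.  The primes dividing \<open>B(n/q)\<close> for some
  prime \<open>q | k\<close>, or \<open>B(n/q\<^sup>M)\<close> for some prime \<open>q | r\<close>, have a product of at most \<open>\<alpha>\<close> to the power
  \<open>n (\<Sum> 1/q + \<Sum> 1/q\<^sup>M)\<close>, which is too small as soon as \<open>\<Sum> 1/q \<le> 3/4\<close> over the primes \<open>q | k\<close>.
  A remaining prime has a rank \<open>d\<close> with \<open>r | d\<close> and \<open>k | d | Rk\<close>, so at most \<open>R\<close> values of \<open>k\<close>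
  yield the same prime.  Finally, as the squares of the reciprocals of the primes add up to at most
  \<open>1/2\<close>, the condition on \<open>k\<close> holds for at least a third of all \<open>k \<le> Y\<close>, and
  \<open>p \<le> B\<^sub>n \<le> x\<close> if \<open>k\<close> is at most a constant times \<open>log x\<close>.\<close>

section \<open>Divisibility of balancing numbers\<close>

text \<open>The Lucas-balancing number C_n, the rational part of (3 + sqrt 8)^n. Together with B_n
  it turns the second-order recursion into a first-order one, namely multiplication by 3 + sqrt
  8.\<close>

definition lucas_balancing :: "nat \<Rightarrow> int" where
  "lucas_balancing n = balancing (Suc n) - 3 * balancing n"

lemma balancing_Suc: "balancing (Suc n) = lucas_balancing n + 3 * balancing n"
  by (simp add: lucas_balancing_def)

lemma lucas_balancing_Suc: "lucas_balancing (Suc n) = 3 * lucas_balancing n + 8 * balancing n"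
  by (simp add: lucas_balancing_def)

lemma lucas_balancing_0 [simp]: "lucas_balancing 0 = 1"
  by (simp add: lucas_balancing_def)

text \<open>Stated for any square root \<open>s\<close> of 8 in any commutative ring, so that it
  serves the real \<open>sqrt 8\<close> as well as both complex roots.\<close>

lemma power_eq_balancing:
  fixes s :: "'a::comm_ring_1"
  assumes "s\<^sup>2 = 8"
  shows "(3 + s) ^ n = of_int (lucas_balancing n) + of_int (balancing n) * s"
proof (induction n)
  case (Suc n)
  have "(3 + s) ^ Suc n = (3 + s) * (of_int (lucas_balancing n) + of_int (balancing n) * s)"
    using Suc by simp
  also have "\<dots> = of_int (3 * lucas_balancing n) + of_int (balancing n) * s\<^sup>2
      + of_int (lucas_balancing n + 3 * balancing n) * s"
    by (simp add: algebra_simps power2_eq_square)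
  also have "\<dots> = of_int (lucas_balancing (Suc n)) + of_int (balancing (Suc n)) * s"
    unfolding assms lucas_balancing_Suc balancing_Suc[of n] by (simp add: algebra_simps)
  finally show ?case .
qed auto

text \<open>These are the coefficients of (3 + s)^m (3 + s)^n. The two formulas are proved together
  because the induction step of each uses the other.\<close>

lemma balancing_add_aux:
  "balancing (m + n) = balancing m * lucas_balancing n + lucas_balancing m * balancing n \<and>
   lucas_balancing (m + n) = lucas_balancing m * lucas_balancing n + 8 * balancing m * balancing n"
proof (induction n)
  case (Suc n)
  then show ?case
    unfolding add_Suc_right balancing_Suc[of "m + n"] balancing_Suc[of n] lucas_balancing_Suc
    by (auto simp: algebra_simps)
qed auto

lemmas balancing_add = balancing_add_aux[THEN conjunct1]
  and lucas_balancing_add = balancing_add_aux[THEN conjunct2]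

text \<open>The norm of 3 + sqrt 8 is 1, hence so is the norm of each of its powers.\<close>

lemma lucas_balancing_norm: "(lucas_balancing n)\<^sup>2 - 8 * (balancing n)\<^sup>2 = 1"
  by (induction n)
    (simp_all add: balancing_Suc lucas_balancing_Suc power2_eq_square algebra_simps)

lemma coprime_balancing_lucas_balancing: "coprime (balancing n) (lucas_balancing n)"
proof (rule coprimeI)
  fix d assume "d dvd balancing n" "d dvd lucas_balancing n"
  then have "d dvd (lucas_balancing n)\<^sup>2 - 8 * (balancing n)\<^sup>2"
    by (simp add: power2_eq_square)
  then show "is_unit d" by (simp only: lucas_balancing_norm)
qed

lemma balancing_bounds: "balancing n \<ge> 0 \<and> lucas_balancing n \<ge> 1"
  by (induction n) (auto simp: balancing_Suc lucas_balancing_Suc)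

lemma balancing_pos: "n > 0 \<Longrightarrow> balancing n > 0"
  using balancing_bounds[of "n - 1"] balancing_Suc[of "n - 1"] by (cases n) auto

abbreviation \<alpha> :: real where "\<alpha> \<equiv> 3 + sqrt 8"

lemma balancing_le_power: "real_of_int (balancing n) \<le> \<alpha> ^ n"
proof -
  have s: "sqrt 8 \<ge> 1" by (simp add: real_le_rsqrt)
  have "real_of_int (balancing n) * 1 \<le> real_of_int (balancing n) * sqrt 8"
    using balancing_bounds[of n] s by (intro mult_left_mono) auto
  then show ?thesis
    using power_eq_balancing[of "sqrt 8" n] balancing_bounds[of n] by simp
qed

text \<open>Expand (C_d + B_d s)^m with s^2 = 8: modulo the square of B_d only C_d^m + m C_d^(m-1)
  B_d s is left.\<close>

lemma balancing_mult_cong: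
  "[balancing (d * m) = int m * lucas_balancing d ^ (m - 1) * balancing d] (mod (balancing d)\<^sup>2) \<and>
   [lucas_balancing (d * m) = lucas_balancing d ^ m] (mod (balancing d)\<^sup>2)"
proof (induction m)
  case (Suc m)
  define B C where "B = balancing d" and "C = lucas_balancing d"
  obtain u where u: "balancing (d * m) = int m * C ^ (m - 1) * B + B\<^sup>2 * u"
    using Suc unfolding B_def C_def cong_iff_lin by (metis cong_sym cong_iff_lin)
  obtain v where v: "lucas_balancing (d * m) = C ^ m + B\<^sup>2 * v"
    using Suc unfolding B_def C_def cong_iff_lin by (metis cong_sym cong_iff_lin)
  \<comment> \<open>For \<open>m = 0\<close> the truncated exponent \<open>m - 1\<close> does not
    combine with \<open>C\<close>, but then the factor \<open>int m\<close> vanishes.\<close>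
  have C: "int m * (C * C ^ (m - 1)) = int m * C ^ m"
    by (cases m) auto
  have "balancing (d * Suc m) - int (Suc m) * C ^ m * B = B\<^sup>2 * (u * C + v * B)"
  proof -
    have "balancing (d * Suc m) = (int m * (C * C ^ (m - 1)) * B + B\<^sup>2 * u * C) + (C ^ m + B\<^sup>2 * v) * B"
      using balancing_add[of "d * m" d] u v by (simp add: B_def C_def algebra_simps)
    then show ?thesis unfolding C by (simp add: algebra_simps)
  qed
  moreover have "lucas_balancing (d * Suc m) - C ^ Suc m
      = B\<^sup>2 * (v * C + 8 * (int m * C ^ (m - 1)) + 8 * B * u)"
    using lucas_balancing_add[of "d * m" d] u v
    by (simp add: B_def C_def algebra_simps power2_eq_square)
  ultimately show ?case
    unfolding cong_iff_dvd_diff B_def C_def by simp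
qed auto

section \<open>The rank of apparition\<close>

text \<open>\<open>LEAST\<close> says nothing if no positive index works, so the facts about the
  rank take an index \<open>n\<close> with \<open>a dvd balancing n\<close> as a witness.\<close>

definition apparition_rank :: "int \<Rightarrow> nat" where
  "apparition_rank a = (LEAST d. d > 0 \<and> a dvd balancing d)"

lemma rank_properties:
  assumes "a dvd balancing n" "n > 0"
  shows "apparition_rank a > 0" "a dvd balancing (apparition_rank a)"
  using LeastI[of "\<lambda>d. d > 0 \<and> a dvd balancing d" n] assms unfolding apparition_rank_def by auto

text \<open>In B(m + d) = B(m) C(d) + C(m) B(d) the second term is a multiple of \<open>a\<close>,
  and C(d) is prime to B(d), hence to \<open>a\<close>.\<close>

lemma dvd_balancing_add_iff:
  assumes "a dvd balancing d"
  shows "a dvd balancing (m + d) \<longleftrightarrow> a dvd balancing m"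
proof -
  have "coprime a (lucas_balancing d)"
    by (rule coprime_divisors[OF assms dvd_refl coprime_balancing_lucas_balancing])
  then have "a dvd balancing m * lucas_balancing d \<longleftrightarrow> a dvd balancing m"
    by (rule coprime_dvd_mult_left_iff)
  moreover have "a dvd lucas_balancing m * balancing d" using assms by (rule dvd_mult)
  ultimately show ?thesis unfolding balancing_add by (simp add: dvd_add_left_iff)
qed

text \<open>Subtracting the rank from \<open>m\<close> changes neither side; below the rank,
  minimality leaves only \<open>m = 0\<close>.\<close>

lemma dvd_balancing_iff_rank_dvd:
  assumes "a dvd balancing n" "n > 0"
  shows "a dvd balancing m \<longleftrightarrow> apparition_rank a dvd m"
proof (induction m rule: less_induct)
  case (less m)
  show ?case
  proof (cases "m < apparition_rank a")
    case True
    then have "m > 0 \<Longrightarrow> \<not> a dvd balancing m"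
      using not_less_Least unfolding apparition_rank_def by blast
    moreover have "m > 0 \<Longrightarrow> \<not> apparition_rank a dvd m" using True by (simp add: nat_dvd_not_less)
    ultimately show ?thesis by (cases "m = 0") auto
  next
    case False
    then show ?thesis
      using less[of "m - apparition_rank a"] rank_properties[OF assms]
        dvd_balancing_add_iff[of a "apparition_rank a" "m - apparition_rank a"]
      by (cases "m = 0") (auto simp: dvd_minus_self)
  qed
qed

section \<open>The law of apparition for odd primes\<close>

text \<open>As an algebraic integer, a rational square root of 8 would be an integer strictly
  between 2 and 3.\<close>

lemma sqrt_8_not_rat: "sqrt 8 \<notin> \<rat>"
proof
  assume "sqrt 8 \<in> \<rat>"
  then have "sqrt 8 \<in> \<int>"
    by (intro rational_algebraic_int_is_int) auto
  then obtain k :: int where k: "sqrt 8 = of_int k" by (auto elim: Ints_cases)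
  have "2 < sqrt 8" "sqrt 8 < 3" by (auto intro: real_less_rsqrt real_less_lsqrt)
  then show False unfolding k by simp
qed

lemma int_coords_unique:
  assumes "real_of_int a + of_int b * sqrt 8 = of_int c + of_int d * sqrt 8"
  shows "a = c \<and> b = d"
proof -
  have eq: "of_int (b - d) * sqrt 8 = real_of_int (c - a)"
    using assms by (simp add: algebra_simps)
  have "b = d"
  proof (rule ccontr)
    assume "b \<noteq> d"
    then have "sqrt 8 = of_int (c - a) / of_int (b - d)" using eq by (simp add: field_simps)
    then show False using sqrt_8_not_rat by (metis Rats_divide Rats_of_int)
  qed
  then show ?thesis using eq by simp
qed

text \<open>The error term is kept explicit, with integral binomial quotients, so that it is visibly
  \<open>p\<close> times an element of any subring containing \<open>x\<close> and
  \<open>y\<close>.\<close>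

lemma power_add_prime:
  fixes x y :: "'a::comm_ring_1"
  assumes "Factorial_Ring.prime p"
  shows "(x + y) ^ p = x ^ p + y ^ p + of_nat p * (\<Sum>k\<in>{0<..<p}. of_nat ((p choose k) div p) * x ^ k * y ^ (p - k))"
proof -
  have p: "p > 0" using assms prime_gt_0_nat by blast
  have "(x + y) ^ p = (\<Sum>k\<in>{..p}. of_nat (p choose k) * x ^ k * y ^ (p - k))"
    by (rule binomial_ring)
  also have "{..p} = insert 0 (insert p {0<..<p})" by auto
  also have "(\<Sum>k\<in>\<dots>. of_nat (p choose k) * x ^ k * y ^ (p - k)) =
      x ^ p + y ^ p + (\<Sum>k\<in>{0<..<p}. of_nat (p choose k) * x ^ k * y ^ (p - k))"
    using p by simp
  also have "(\<Sum>k\<in>{0<..<p}. of_nat (p choose k) * x ^ k * y ^ (p - k)) =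
     (\<Sum>k\<in>{0<..<p}. of_nat p * (of_nat ((p choose k) div p) * x ^ k * y ^ (p - k)))"
  proof (rule sum.cong)
    fix k assume "k \<in> {0<..<p}"
    then have "p dvd (p choose k)" using assms by (intro dvd_choose_prime) auto
    then have "(p choose k) = p * ((p choose k) div p)" by simp
    then show "of_nat (p choose k) * x ^ k * y ^ (p - k) =
       of_nat p * (of_nat ((p choose k) div p) * x ^ k * y ^ (p - k))"
      by (metis (no_types, lifting) mult.assoc of_nat_mult)
  qed auto
  finally show ?thesis by (simp add: sum_distrib_left)
qed

text \<open>Compare coordinates in (3 + s)^p = 3^p + s^p + p R with s = sqrt 8, where s^p =
  8^((p-1)/2) s because \<open>p\<close> is odd.\<close>

lemma balancing_prime_cong:
  assumes "Factorial_Ring.prime p" "odd p"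
  shows "[balancing p = 8 ^ ((p - 1) div 2)] (mod int p)" "[lucas_balancing p = 3 ^ p] (mod int p)"
proof -
  define s where "s = sqrt 8"
  have s: "s\<^sup>2 = 8" by (simp add: s_def)
  \<comment> \<open>The ring Z[sqrt 8]. The closure properties below only serve to show that the
    error term \<open>R\<close> has integer coordinates.\<close>
  define Z where "Z = {real_of_int x + of_int y * s | x y. True}"
  have Zadd: "u + v \<in> Z" if uvZ: "u \<in> Z" "v \<in> Z" for u v
  proof -
    obtain a b c d where "u = of_int a + of_int b * s" "v = of_int c + of_int d * s"
      using uvZ unfolding Z_def by blast
    then have "u + v = of_int (a + c) + of_int (b + d) * s" by (simp add: algebra_simps)
    then show ?thesis unfolding Z_def by blast
  qed
  have Zmult: "u * v \<in> Z" if uvZ: "u \<in> Z" "v \<in> Z" for u v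
  proof -
    obtain a b c d where uv: "u = of_int a + of_int b * s" "v = of_int c + of_int d * s"
      using uvZ unfolding Z_def by blast
    have "u * v = of_int a * of_int c + of_int b * of_int d * s\<^sup>2 + (of_int a * of_int d + of_int b * of_int c) * s"
      unfolding uv by (simp add: algebra_simps power2_eq_square)
    also have "\<dots> = of_int (a * c + 8 * b * d) + of_int (a * d + b * c) * s"
      by (simp add: s)
    finally show ?thesis unfolding Z_def by blast
  qed
  have Zint: "of_int k \<in> Z" for k
  proof -
    have "of_int k = of_int k + of_int 0 * s" by simp
    then show ?thesis unfolding Z_def by blast
  qed
  have Zs: "s \<in> Z"
  proof -
    have "s = of_int 0 + of_int 1 * s" by simp
    then show ?thesis unfolding Z_def by blast
  qed
  have Zpow: "u ^ n \<in> Z" if "u \<in> Z" for u n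
    using that Zint[of 1] by (induction n) (auto intro: Zmult)
  have Zsum: "sum f A \<in> Z" if "\<And>k. k \<in> A \<Longrightarrow> f k \<in> Z" for f :: "nat \<Rightarrow> real" and A
    using that Zint[of 0] by (induction A rule: infinite_finite_induct) (auto intro: Zadd)
  define R where "R = (\<Sum>k\<in>{0<..<p}. of_nat ((p choose k) div p) * 3 ^ k * s ^ (p - k))"
  have "R \<in> Z"
    unfolding R_def using Zint[of 3] Zs
    by (intro Zsum Zmult Zpow) (auto simp: Zint[of "int _", simplified])
  then obtain u v where R: "R = of_int u + of_int v * s" unfolding Z_def by blast
  obtain h where h: "p = 2 * h + 1" using assms(2) by (auto elim: oddE)
  have sp: "s ^ p = 8 ^ h * s" by (simp add: h power_mult s)
  have "of_int (lucas_balancing p) + of_int (balancing p) * s = (3 + s) ^ p"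
    using power_eq_balancing[OF s, of p] by simp
  also have "\<dots> = 3 ^ p + s ^ p + of_nat p * R"
    unfolding R_def by (rule power_add_prime) fact
  also have "\<dots> = of_int (3 ^ p + int p * u) + of_int (8 ^ h + int p * v) * s"
    by (simp add: R sp algebra_simps)
  finally have "lucas_balancing p = 3 ^ p + int p * u \<and> balancing p = 8 ^ h + int p * v"
    unfolding s_def by (rule int_coords_unique)
  moreover have "(p - 1) div 2 = h" using h by simp
  ultimately show "[balancing p = 8 ^ ((p - 1) div 2)] (mod int p)"
    "[lucas_balancing p = 3 ^ p] (mod int p)"
    by (auto simp: cong_iff_dvd_diff)
qed

lemma odd_prime_not_dvd_power_two:
  assumes "Factorial_Ring.prime p" "odd p"
  shows "\<not> int p dvd 2 ^ k"
proof
  assume "int p dvd 2 ^ k"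
  then have "int p dvd 2" using assms(1) by (simp add: prime_dvd_power_int)
  then have "p dvd 2" by presburger
  then have "p = 2" using assms(1) by (simp add: primes_dvd_imp_eq)
  then show False using assms(2) by simp
qed

lemma Legendre_eight:
  assumes "Factorial_Ring.prime p" "odd p"
  shows "Legendre 8 (int p) = 1 \<or> Legendre 8 (int p) = - 1"
    "[Legendre 8 (int p) = 8 ^ ((p - 1) div 2)] (mod int p)"
proof -
  have "p > 2" using assms prime_ge_2_nat[of p] by (cases "p = 2") auto
  then show "[Legendre 8 (int p) = 8 ^ ((p - 1) div 2)] (mod int p)"
    by (intro euler_criterion) (use assms in auto)
  have "\<not> [8 = 0] (mod int p)"
    using odd_prime_not_dvd_power_two[OF assms, of 3] by (simp add: cong_0_iff)
  then show "Legendre 8 (int p) = 1 \<or> Legendre 8 (int p) = - 1"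
    by (simp add: Legendre_def)
qed

text \<open>The index in \<open>balancing_non_wieferich\<close>. It gets its name because
  \<open>p\<close> divides B at this index, so that it is a multiple of the rank of
  \<open>p\<close>.\<close>

definition rank_multiple :: "nat \<Rightarrow> nat" where
  "rank_multiple p = nat (int p - Legendre 8 (int p))"

lemma int_rank_multiple:
  assumes "Factorial_Ring.prime p" "odd p"
  shows "int (rank_multiple p) = int p - Legendre 8 (int p)"
  using Legendre_eight(1)[OF assms] prime_ge_2_nat[OF assms(1)] unfolding rank_multiple_def by auto

text \<open>Modulo \<open>p\<close>, B(p) is the Legendre symbol by Euler's criterion and C(p) is 3
  by Fermat. One step of the recursion then gives B(p-1) = 3 B(p) - C(p) = 0 or B(p+1) = C(p) + 3
  B(p) = 0, according to the symbol.\<close>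

lemma dvd_balancing_rank_multiple:
  assumes "Factorial_Ring.prime p" "odd p"
  shows "int p dvd balancing (rank_multiple p)"
proof -
  have p: "p > 0" using assms(2) by (cases p) auto
  define L where "L = Legendre 8 (int p)"
  have B: "[balancing p = L] (mod int p)"
    using balancing_prime_cong(1)[OF assms] Legendre_eight(2)[OF assms]
    unfolding L_def by (meson cong_sym cong_trans)
  have "[3 ^ p = 3] (mod p)"
  proof (cases "p dvd 3")
    case True
    then show ?thesis using p
      by (meson cong_0_iff cong_sym cong_trans dvd_trans dvd_power)
  next
    case False
    then have "[3 ^ (p - 1) = 1] (mod p)" using assms(1) by (intro fermat_theorem)
    then have "[3 * 3 ^ (p - 1) = 3 * 1] (mod p)" by (rule cong_scalar_left)
    then show ?thesis using p by (cases p) auto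
  qed
  then have "[3 ^ p = 3] (mod int p)"
    by (metis cong_int_iff of_nat_numeral of_nat_power)
  then have C: "[lucas_balancing p = 3] (mod int p)"
    using balancing_prime_cong(2)[OF assms] cong_trans by blast
  from Legendre_eight(1)[OF assms] show ?thesis
  proof
    assume L: "Legendre 8 (int p) = 1"
    then have rm: "rank_multiple p = p - 1" using p by (simp add: rank_multiple_def)
    have "balancing p = lucas_balancing (p - 1) + 3 * balancing (p - 1)"
      "lucas_balancing p = 3 * lucas_balancing (p - 1) + 8 * balancing (p - 1)"
      using balancing_Suc[of "p - 1"] lucas_balancing_Suc[of "p - 1"] p by auto
    then have "balancing (p - 1) = 3 * balancing p - lucas_balancing p" by simp
    moreover have "[3 * balancing p - lucas_balancing p = 3 * 1 - 3] (mod int p)"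
      using B C L unfolding L_def by (intro cong_diff cong_mult) auto
    ultimately show ?thesis by (simp add: rm cong_0_iff)
  next
    assume L: "Legendre 8 (int p) = - 1"
    then have rm: "rank_multiple p = Suc p" by (simp add: rank_multiple_def nat_add_distrib)
    have "[lucas_balancing p + 3 * balancing p = 3 + 3 * (- 1)] (mod int p)"
      using B C L unfolding L_def by (intro cong_add cong_mult) auto
    then show ?thesis by (simp only: rm balancing_Suc) (simp add: cong_0_iff)
  qed
qed

section \<open>Non-Wieferich primes from exact divisors\<close>

text \<open>With d the rank and d m = p - (8/p), divisibility of B(d m) by p^2 would pass to m
  C(d)^(m-1) B(d), then to B(d), since m and C(d) are prime to p, and finally to B(n).\<close>

lemma non_wieferich_if_exactly_divides:
  assumes p: "Factorial_Ring.prime p" "odd p"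
    and n: "n > 0" "int p dvd balancing n" "\<not> (int p)\<^sup>2 dvd balancing n"
  shows "balancing_non_wieferich p"
proof -
  define d where "d = apparition_rank (int p)"
  have d: "d dvd n" "int p dvd balancing d"
    using n dvd_balancing_iff_rank_dvd rank_properties unfolding d_def by blast+
  have "d dvd rank_multiple p"
    unfolding d_def using dvd_balancing_iff_rank_dvd[OF n(2,1)] dvd_balancing_rank_multiple[OF p] by blast
  then obtain m where m: "rank_multiple p = d * m" by blast
  have pm: "\<not> p dvd m"
  proof
    assume "p dvd m"
    then have "p dvd rank_multiple p" using m by simp
    then have "int p dvd int (rank_multiple p)" by simp
    then have "int p dvd int p - Legendre 8 (int p)"
      using int_rank_multiple[OF p] by simp
    then have "int p dvd int p - (int p - Legendre 8 (int p))" by (rule dvd_diff[OF dvd_refl])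
    then have "int p dvd Legendre 8 (int p)" by simp
    then have "int p dvd 1" using Legendre_eight(1)[OF p] by auto
    then show False using p(1) by auto
  qed
  have "\<not> (int p)\<^sup>2 dvd balancing (rank_multiple p)"
  proof
    assume dvd: "(int p)\<^sup>2 dvd balancing (rank_multiple p)"
    have "(int p)\<^sup>2 dvd (balancing d)\<^sup>2" using d(2) by (simp add: dvd_power_same)
    then have "[balancing (d * m) = int m * lucas_balancing d ^ (m - 1) * balancing d] (mod (int p)\<^sup>2)"
      using balancing_mult_cong[of d m] cong_dvd_modulus by blast
    then have "(int p)\<^sup>2 dvd int m * lucas_balancing d ^ (m - 1) * balancing d"
      using dvd cong_dvd_iff unfolding m by blast
    moreover have "coprime ((int p)\<^sup>2) (int m * lucas_balancing d ^ (m - 1))"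
    proof -
      have "coprime (int p) (lucas_balancing d)"
        by (rule coprime_divisors[OF d(2) dvd_refl coprime_balancing_lucas_balancing])
      moreover have "coprime (int p) (int m)"
        using pm p(1) prime_imp_coprime[of p m] by simp
      ultimately show ?thesis by simp
    qed
    ultimately have "(int p)\<^sup>2 dvd balancing d" by (simp add: coprime_dvd_mult_right_iff)
    \<comment> \<open>The rank criterion is applied with B(d) itself as the modulus: its rank
      divides d, hence n.\<close>
    also have "balancing d dvd balancing n"
    proof -
      have "d > 0" using d(1) n(1) by (cases d) auto
      have "apparition_rank (balancing d) dvd d"
        using dvd_balancing_iff_rank_dvd[of "balancing d" d d] \<open>d > 0\<close> by simp
      then show ?thesis
        using dvd_balancing_iff_rank_dvd[of "balancing d" d n] \<open>d > 0\<close> d(1) by auto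
    qed
    finally show False using n(3) by simp
  qed
  then show ?thesis using p
    unfolding balancing_non_wieferich_def rank_multiple_def cong_0_iff by simp
qed

text \<open>The rank divides p - (8/p), which is p - 1 or p + 1.\<close>

lemma prime_cong_if_dvd_rank:
  assumes p: "Factorial_Ring.prime p" "odd p"
    and n: "n > 0" "int p dvd balancing n"
    and r: "r dvd int (apparition_rank (int p))"
  shows "[int p = 1] (mod r) \<or> [int p = - 1] (mod r)"
proof -
  have "apparition_rank (int p) dvd rank_multiple p"
    using dvd_balancing_iff_rank_dvd[OF n(2,1)] dvd_balancing_rank_multiple[OF p] by blast
  then have "r dvd int (rank_multiple p)" using r by (meson dvd_trans int_dvd_int_iff)
  also have "int (rank_multiple p) = int p - Legendre 8 (int p)"
    by (rule int_rank_multiple[OF p])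
  finally show ?thesis using Legendre_eight(1)[OF p] by (auto simp: cong_iff_dvd_diff)
qed

section \<open>The ring of integers of the field of the square root of 2\<close>

definition quad :: "rat \<Rightarrow> rat \<Rightarrow> complex" where
  "quad a b = of_rat a + of_rat b * complex_of_real (sqrt 2)"

lemma sqrt_2_squared: "complex_of_real (sqrt 2) * complex_of_real (sqrt 2) = 2"
  by (simp flip: of_real_mult)

lemma of_rat_complex: "(of_rat q :: complex) = complex_of_real (of_rat q)"
  by (cases q) (simp add: of_rat_rat)

lemma sqrt_2_not_rat: "sqrt 2 \<noteq> of_rat q"
proof
  assume "sqrt 2 = of_rat q"
  moreover have "sqrt 8 = 2 * sqrt 2" using real_sqrt_mult[of 4 2] by simp
  ultimately have "sqrt 8 \<in> \<rat>" by simp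
  then show False using sqrt_8_not_rat by simp
qed

lemma quad_eq_iff [simp]: "quad a b = quad c d \<longleftrightarrow> a = c \<and> b = d"
proof
  assume "quad a b = quad c d"
  then have "complex_of_real (of_rat a + of_rat b * sqrt 2) = complex_of_real (of_rat c + of_rat d * sqrt 2)"
    by (simp add: quad_def of_rat_complex)
  then have eq: "of_rat a + of_rat b * sqrt 2 = of_rat c + of_rat d * sqrt 2"
    by (simp only: of_real_eq_iff)
  have "b = d"
  proof (rule ccontr)
    assume "b \<noteq> d"
    then have ne: "of_rat (b - d) \<noteq> (0::real)" by simp
    have "of_rat (b - d) * sqrt 2 = of_rat (c - a)"
      using eq by (simp add: of_rat_diff algebra_simps)
    then have "sqrt 2 = of_rat (c - a) / of_rat (b - d)" using ne by (simp add: field_simps)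
    then have "sqrt 2 = of_rat ((c - a) / (b - d))" by (simp add: of_rat_divide)
    then show False using sqrt_2_not_rat by blast
  qed
  then show "a = c \<and> b = d" using eq by simp
qed auto

lemma quad_add: "quad a b + quad c d = quad (a + c) (b + d)"
  by (simp add: quad_def of_rat_add algebra_simps)

lemma quad_minus: "- quad a b = quad (- a) (- b)"
  by (simp add: quad_def of_rat_minus)

lemma quad_diff: "quad a b - quad c d = quad (a - c) (b - d)"
  by (simp add: quad_def of_rat_diff algebra_simps)

lemma quad_mult: "quad a b * quad c d = quad (a * c + 2 * b * d) (a * d + b * c)"
proof -
  have "quad a b * quad c d = of_rat a * of_rat c +
      of_rat b * of_rat d * (complex_of_real (sqrt 2) * complex_of_real (sqrt 2)) +
      (of_rat a * of_rat d + of_rat b * of_rat c) * complex_of_real (sqrt 2)"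
    by (simp add: quad_def algebra_simps)
  then show ?thesis
    unfolding sqrt_2_squared quad_def by (simp add: of_rat_add of_rat_mult algebra_simps)
qed

lemma quad_rat: "quad a 0 = of_rat a"
  by (simp add: quad_def)

lemma quad_eq_0_iff [simp]: "quad a b = 0 \<longleftrightarrow> a = 0 \<and> b = 0"
  using quad_eq_iff[of a b 0 0] by (simp add: quad_rat del: quad_eq_iff)

lemma quad_eq_1_iff [simp]: "quad a b = 1 \<longleftrightarrow> a = 1 \<and> b = 0"
  using quad_eq_iff[of a b 1 0] by (simp add: quad_rat del: quad_eq_iff)

text \<open>The form is the product of \<open>quad a b\<close> with its conjugate, and a product of
  complex numbers vanishes only if a factor does.\<close>

lemma norm_form_eq_0_iff: "a\<^sup>2 - 2 * b\<^sup>2 = 0 \<longleftrightarrow> a = 0 \<and> b = (0::rat)"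
proof
  assume eq: "a\<^sup>2 - 2 * b\<^sup>2 = 0"
  have "quad a b * quad a (- b) = quad (a\<^sup>2 - 2 * b\<^sup>2) 0"
    by (simp add: quad_mult power2_eq_square)
  then have "quad a b = 0 \<or> quad a (- b) = 0" unfolding eq by (simp add: quad_rat)
  then show "a = 0 \<and> b = 0" by auto
qed auto

lemma quad_inverse:
  "inverse (quad a b) = quad (a / (a\<^sup>2 - 2 * b\<^sup>2)) (- b / (a\<^sup>2 - 2 * b\<^sup>2))"
proof (cases "quad a b = 0")
  case False
  define n where "n = a\<^sup>2 - 2 * b\<^sup>2"
  have n: "n \<noteq> 0" using False norm_form_eq_0_iff[of a b] by (simp add: n_def)
  have "a * (a / n) + 2 * b * (- b / n) = (a\<^sup>2 - 2 * b\<^sup>2) / n"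
    by (simp add: power2_eq_square diff_divide_distrib)
  then have "quad a b * quad (a / n) (- b / n) = quad (n / n) 0"
    by (simp add: quad_mult n_def)
  also have "\<dots> = 1" using n by simp
  finally show ?thesis unfolding n_def[symmetric]
    by (rule inverse_unique)
next
  case True
  then have "a = 0" "b = 0" by simp_all
  then show ?thesis by (simp add: quad_def)
qed

lemma complex_field_simps [simp]:
  "carrier complex_field = UNIV" "\<one>\<^bsub>complex_field\<^esub> = 1" "\<zero>\<^bsub>complex_field\<^esub> = 0"
  "x \<otimes>\<^bsub>complex_field\<^esub> y = x * y" "x \<oplus>\<^bsub>complex_field\<^esub> y = x + y"
  by (simp_all add: ring_of_type_algebra_def)

lemma complex_field_a_inv: "\<ominus>\<^bsub>complex_field\<^esub> x = - x"
proof -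
  interpret cring complex_field by (rule cring_from_type_algebra)
  show ?thesis using minus_equality[of "- x" x] by simp
qed

lemma complex_field_m_inv: "x \<noteq> 0 \<Longrightarrow> inv\<^bsub>complex_field\<^esub> x = inverse x"
proof -
  interpret cring complex_field by (rule cring_from_type_algebra)
  show "x \<noteq> 0 \<Longrightarrow> inv\<^bsub>complex_field\<^esub> x = inverse x"
    using comm_inv_char[of x "inverse x"] by simp
qed

text \<open>One inclusion is closure of the right-hand side under the field operations. For the
  other, the rationals have to be built up from 1, since the square root of 2 is the only
  generator.\<close>

lemma Q_sqrt2_eq: "Q_sqrt2 = {quad a b | a b. True}"
proof (intro equalityI subsetI)
  fix z assume "z \<in> Q_sqrt2"
  then show "z \<in> {quad a b | a b. True}"
    unfolding Q_sqrt2_def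
  proof (induction rule: generate_field.induct)
    case one
    have "1 = quad 1 0" by (simp add: quad_rat)
    then show ?case by auto
  next
    case (incl h)
    then have "h = quad 0 1" by (simp add: quad_def)
    then show ?case by auto
  next
    case (a_inv h)
    then show ?case by (auto simp: complex_field_a_inv quad_minus)
  next
    case (m_inv h)
    then obtain a b where h: "h = quad a b" by auto
    have "inv\<^bsub>complex_field\<^esub> h = inverse h"
      using m_inv by (intro complex_field_m_inv) simp
    then show ?case unfolding h quad_inverse by blast
  next
    case (eng_add h1 h2)
    then show ?case by (auto simp: quad_add)
  next
    case (eng_mult h1 h2)
    then obtain a b c d where "h1 = quad a b" "h2 = quad c d" by auto
    then have "h1 * h2 = quad (a * c + 2 * b * d) (a * d + b * c)" by (simp add: quad_mult)
    then show ?case by auto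
  qed
next
  fix z assume "z \<in> {quad a b | a b. True}"
  then obtain a b where z: "z = quad a b" by auto
  let ?F = "generate_field complex_field {complex_of_real (sqrt 2)}"
  have add: "x + y \<in> ?F" if "x \<in> ?F" "y \<in> ?F" for x y
    using generate_field.eng_add[OF that] by simp
  have mult: "x * y \<in> ?F" if "x \<in> ?F" "y \<in> ?F" for x y
    using generate_field.eng_mult[OF that] by simp
  have one: "1 \<in> ?F" using generate_field.one[of complex_field] by simp
  have neg: "- x \<in> ?F" if "x \<in> ?F" for x
    using generate_field.a_inv[OF that] by (simp add: complex_field_a_inv)
  have inv: "inverse x \<in> ?F" if "x \<in> ?F" "x \<noteq> 0" for x
    using generate_field.m_inv[OF that(1)] that(2) by (simp add: complex_field_m_inv)
  have nat: "of_nat n \<in> ?F" for n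
  proof (induction n)
    case 0
    show ?case using add[OF one neg[OF one]] by simp
  next
    case (Suc n)
    show ?case using add[OF one Suc] by simp
  qed
  have int: "of_int k \<in> ?F" for k
    using nat neg[OF nat] by (cases k rule: int_cases2) auto
  have rat: "of_rat q \<in> ?F" for q
  proof (cases q)
    case (Fract m n)
    then have "(of_rat q :: complex) = of_int m * inverse (of_int n)" by (simp add: of_rat_rat divide_inverse)
    then show ?thesis using mult[OF int inv[OF int[of n]], of m] Fract(2) by simp
  qed
  show "z \<in> Q_sqrt2" unfolding Q_sqrt2_def z quad_def
    by (intro add mult rat generate_field.incl) simp
qed

section \<open>The ring Z[sqrt 2], its norm and Euclidean division\<close>

definition zsqrt2 :: "complex set" where
  "zsqrt2 = {quad (of_int x) (of_int y) | x y. True}"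

lemma zsqrt2_E:
  assumes "z \<in> zsqrt2"
  obtains x y where "z = quad (of_int x) (of_int y)"
  using assms unfolding zsqrt2_def by blast

lemma zsqrt2_I: "quad (of_int x) (of_int y) \<in> zsqrt2"
  unfolding zsqrt2_def by blast

lemma zsqrt2_add [intro]:
  assumes "a \<in> zsqrt2" "b \<in> zsqrt2"
  shows "a + b \<in> zsqrt2"
  by (rule zsqrt2_E[OF assms(1)], rule zsqrt2_E[OF assms(2)])
    (simp only: quad_add of_int_add[symmetric] zsqrt2_I)

lemma zsqrt2_mult [intro]:
  assumes "a \<in> zsqrt2" "b \<in> zsqrt2"
  shows "a * b \<in> zsqrt2"
proof -
  obtain x y u v where "a = quad (of_int x) (of_int y)" "b = quad (of_int u) (of_int v)"
    using assms by (meson zsqrt2_E)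
  then have "a * b = quad (of_int (x * u + 2 * y * v)) (of_int (x * v + y * u))"
    by (simp add: quad_mult)
  then show ?thesis by (simp only: zsqrt2_I)
qed

lemma zsqrt2_of_int [intro, simp]: "of_int k \<in> zsqrt2"
  using zsqrt2_I[of k 0] by (simp add: quad_rat)

lemma zsqrt2_of_nat [intro, simp]: "of_nat k \<in> zsqrt2"
  using zsqrt2_of_int[of "int k"] by simp

lemma zsqrt2_0 [simp]: "0 \<in> zsqrt2" and zsqrt2_1 [simp]: "1 \<in> zsqrt2"
  using zsqrt2_of_int[of 0] zsqrt2_of_int[of 1] by auto

lemma zsqrt2_minus [intro]: "a \<in> zsqrt2 \<Longrightarrow> - a \<in> zsqrt2"
  using zsqrt2_mult[OF zsqrt2_of_int[of "- 1"]] by simp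

lemma zsqrt2_power [intro]: "a \<in> zsqrt2 \<Longrightarrow> a ^ n \<in> zsqrt2"
  by (induction n) auto

lemma zsqrt2_sum: "(\<And>i. i \<in> A \<Longrightarrow> f i \<in> zsqrt2) \<Longrightarrow> sum f A \<in> zsqrt2"
  by (induction A rule: infinite_finite_induct) auto

lemma zsqrt2_sqrt_2: "complex_of_real (sqrt 2) \<in> zsqrt2"
  using zsqrt2_I[of 0 1] by (simp add: quad_def)

lemma zsqrt2_subset: "zsqrt2 \<subseteq> Q_sqrt2"
  unfolding zsqrt2_def Q_sqrt2_eq by blast

text \<open>The field norm down to the rationals; \<open>THE\<close> is justified by the uniqueness
  of the coordinates.\<close>

definition qnorm :: "complex \<Rightarrow> rat" where
  "qnorm z = (THE m. \<exists>a b. z = quad a b \<and> m = a\<^sup>2 - 2 * b\<^sup>2)"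

lemma qnorm_quad [simp]: "qnorm (quad a b) = a\<^sup>2 - 2 * b\<^sup>2"
  unfolding qnorm_def by (rule the_equality) auto

lemma Q_sqrt2_E:
  assumes "z \<in> Q_sqrt2"
  obtains a b where "z = quad a b"
  using assms unfolding Q_sqrt2_eq by blast

lemma quad_in_Q_sqrt2 [simp]: "quad a b \<in> Q_sqrt2"
  unfolding Q_sqrt2_eq by blast

lemma qnorm_mult:
  assumes "a \<in> Q_sqrt2" "b \<in> Q_sqrt2"
  shows "qnorm (a * b) = qnorm a * qnorm b"
proof -
  obtain x y u v where "a = quad x y" "b = quad u v"
    using assms by (meson Q_sqrt2_E)
  then show ?thesis
    by (simp add: quad_mult power2_eq_square algebra_simps)
qed

lemma qnorm_zsqrt2:
  assumes "a \<in> zsqrt2"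
  obtains k where "qnorm a = of_int k"
proof -
  obtain x y where "a = quad (of_int x) (of_int y)" using assms by (rule zsqrt2_E)
  then have "qnorm a = of_int (x\<^sup>2 - 2 * y\<^sup>2)" by simp
  then show ?thesis using that by blast
qed

lemma qnorm_eq_0_iff: "a \<in> Q_sqrt2 \<Longrightarrow> qnorm a = 0 \<longleftrightarrow> a = 0"
  by (erule Q_sqrt2_E) (simp only: qnorm_quad norm_form_eq_0_iff quad_eq_0_iff)

lemma Q_sqrt2_field:
  shows "a \<in> Q_sqrt2 \<Longrightarrow> b \<in> Q_sqrt2 \<Longrightarrow> a * b \<in> Q_sqrt2"
    "a \<in> Q_sqrt2 \<Longrightarrow> inverse a \<in> Q_sqrt2"
  by (erule Q_sqrt2_E, erule Q_sqrt2_E, simp add: quad_mult)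
    (erule Q_sqrt2_E, simp add: quad_inverse)

lemma qnorm_abs_ge_1:
  assumes "a \<in> zsqrt2" "a \<noteq> 0"
  shows "\<bar>qnorm a\<bar> \<ge> 1"
proof -
  obtain k where k: "qnorm a = of_int k" using assms(1) by (rule qnorm_zsqrt2)
  have "qnorm a \<noteq> 0" using assms zsqrt2_subset qnorm_eq_0_iff by blast
  then have "\<bar>k\<bar> \<ge> 1" using k by auto
  then show ?thesis unfolding k by (simp flip: of_int_abs)
qed

text \<open>Rounding both coordinates leaves u and v of absolute value at most 1/2, so u^2 - 2 v^2
  lies between -1/2 and 1/4. This makes Z[sqrt 2] norm-Euclidean.\<close>

lemma nearest_zsqrt2:
  assumes "z \<in> Q_sqrt2"
  obtains q where "q \<in> zsqrt2" "\<bar>qnorm (z - q)\<bar> < 1"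
proof -
  obtain a b where z: "z = quad a b" using assms by (rule Q_sqrt2_E)
  define u v where "u = a - of_int (round a)" and "v = b - of_int (round b)"
  have "\<bar>u\<bar> \<le> 1 / 2" "\<bar>v\<bar> \<le> 1 / 2"
    using of_int_round_abs_le[of a] of_int_round_abs_le[of b] by (auto simp: u_def v_def abs_minus_commute)
  then have "u\<^sup>2 \<le> (1 / 2)\<^sup>2" "v\<^sup>2 \<le> (1 / 2)\<^sup>2"
    by (metis power2_abs power_mono abs_ge_zero)+
  then have "u\<^sup>2 \<le> 1 / 4" "v\<^sup>2 \<le> 1 / 4" by (simp_all add: power_one_over)
  then have "\<bar>u\<^sup>2 - 2 * v\<^sup>2\<bar> < 1"
    using zero_le_power2[of u] zero_le_power2[of v]
    unfolding abs_less_iff by linarith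
  then show ?thesis
    using that[OF zsqrt2_I[of "round a" "round b"]] by (simp add: z quad_diff u_def v_def)
qed

text \<open>A nonzero element of least absolute norm generates: the remainder \<open>e\<close> of
  any other element on division by it has smaller norm, so it is 0.\<close>

lemma zsqrt2_principal:
  assumes I: "I \<subseteq> zsqrt2" "b \<in> I" "b \<noteq> 0"
    and add: "\<And>x y. x \<in> I \<Longrightarrow> y \<in> I \<Longrightarrow> x + y \<in> I"
    and mult: "\<And>x y. x \<in> zsqrt2 \<Longrightarrow> y \<in> I \<Longrightarrow> x * y \<in> I"
  obtains g where "g \<in> I" "g \<noteq> 0" "I = {g * y | y. y \<in> zsqrt2}"
proof -
  \<comment> \<open>The absolute norm as a natural number, which allows taking a minimum; on
    Z[sqrt 2] the floor changes nothing.\<close>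
  define m where "m z = nat \<lfloor>\<bar>qnorm z\<bar>\<rfloor>" for z
  have m: "\<bar>qnorm z\<bar> = of_nat (m z)" if z: "z \<in> zsqrt2" for z
  proof -
    obtain k where "qnorm z = of_int k" using z by (rule qnorm_zsqrt2)
    then show ?thesis unfolding m_def by (simp flip: of_int_abs)
  qed
  obtain g where g: "g \<in> I" "g \<noteq> 0" "\<And>y. y \<in> I \<Longrightarrow> y \<noteq> 0 \<Longrightarrow> m g \<le> m y"
    using ex_has_least_nat[of "\<lambda>g. g \<in> I \<and> g \<noteq> 0" b m] I by blast
  have gO: "g \<in> zsqrt2" "g \<in> Q_sqrt2" using g(1) I(1) zsqrt2_subset by auto
  have "y \<in> {g * y | y. y \<in> zsqrt2}" if y: "y \<in> I" for y
  proof -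
    have yO: "y \<in> zsqrt2" using y I(1) by auto
    then have "y * inverse g \<in> Q_sqrt2" using Q_sqrt2_field gO zsqrt2_subset by blast
    then obtain q where q: "q \<in> zsqrt2" "\<bar>qnorm (y * inverse g - q)\<bar> < 1"
      by (rule nearest_zsqrt2)
    define e where "e = y + (- q) * g"
    have eI: "e \<in> I" unfolding e_def using y q(1) g(1) by (intro add mult zsqrt2_minus)
    have eq: "e = (y * inverse g - q) * g" using g(2) by (simp add: e_def field_simps)
    have "qnorm e = qnorm (y * inverse g - q) * qnorm g"
    proof -
      have "e * inverse g \<in> Q_sqrt2" using eI I(1) zsqrt2_subset Q_sqrt2_field gO by blast
      moreover have "e * inverse g = y * inverse g - q" using eq g(2) by simp
      ultimately show ?thesis unfolding eq using gO qnorm_mult by metis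
    qed
    then have "\<bar>qnorm e\<bar> = \<bar>qnorm (y * inverse g - q)\<bar> * \<bar>qnorm g\<bar>" by (simp add: abs_mult)
    also have "\<dots> < 1 * \<bar>qnorm g\<bar>"
      using q(2) qnorm_abs_ge_1[OF gO(1) g(2)] by (intro mult_strict_right_mono) auto
    finally have "m e < m g" using m[OF gO(1)] m[of e] eI I(1) by auto
    then have "e = 0" using g(3)[OF eI] by (meson not_less)
    then have "y = g * q" by (simp add: e_def)
    then show ?thesis using q(1) by blast
  qed
  moreover have "g * y \<in> I" if "y \<in> zsqrt2" for y
    using mult[OF that g(1)] by (simp add: mult.commute)
  ultimately have "I = {g * y | y. y \<in> zsqrt2}" by blast
  then show ?thesis using that g by blast
qed

section \<open>The integral elements\<close>

lemma zsqrt2_integrally_closed: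
  assumes "algebraic_int x" "x \<in> Q_sqrt2"
  shows "x \<in> zsqrt2"
proof -
  obtain p :: "complex poly" where p: "lead_coeff p = 1" "\<And>i. coeff p i \<in> \<int>" "poly p x = 0"
    using assms(1) by (auto elim: algebraic_int.cases)
  define n where "n = degree p"
  have n: "n > 0"
  proof (rule ccontr)
    assume "\<not> n > 0"
    then obtain c where "p = [:c:]" unfolding n_def using degree_eq_zeroE by blast
    then show False using p by simp
  qed
  have xn: "x ^ n = - (\<Sum>i<n. coeff p i * x ^ i)"
  proof -
    have "poly p x = (\<Sum>i\<le>n. coeff p i * x ^ i)" by (simp add: poly_altdef n_def)
    also have "{..n} = insert n {..<n}" by auto
    also have "(\<Sum>i\<in>\<dots>. coeff p i * x ^ i) = x ^ n + (\<Sum>i<n. coeff p i * x ^ i)"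
      using p(1) by (simp add: n_def)
    finally show ?thesis using p(3) by (simp add: eq_neg_iff_add_eq_0)
  qed
  \<comment> \<open>The product of the denominators of the two coordinates.\<close>
  obtain d where d: "d \<in> zsqrt2" "d \<noteq> 0" "d * x \<in> zsqrt2"
  proof -
    obtain a b where x: "x = quad a b" using assms(2) by (rule Q_sqrt2_E)
    obtain a1 a2 where a: "a = Rat.Fract a1 a2" "a2 > 0" by (cases a) auto
    obtain b1 b2 where b: "b = Rat.Fract b1 b2" "b2 > 0" by (cases b) auto
    have a': "of_int a2 * a = of_int a1" and b': "of_int b2 * b = of_int b1"
      using a b by (simp_all add: Fract_of_int_quotient)
    have "of_int (a2 * b2) * x = quad (of_int (a2 * b2)) 0 * quad a b"
      by (simp add: x quad_rat of_rat_mult)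
    also have "\<dots> = quad (of_int b2 * (of_int a2 * a)) (of_int a2 * (of_int b2 * b))"
      by (simp add: quad_mult)
    also have "\<dots> = quad (of_int (b2 * a1)) (of_int (a2 * b1))"
      unfolding a' b' by simp
    finally have "of_int (a2 * b2) * x \<in> zsqrt2" by (simp only: zsqrt2_I)
    then show ?thesis using that[of "of_int (a2 * b2)"] a b zsqrt2_of_int[of "a2 * b2"] by simp
  qed
  \<comment> \<open>The ideal \<open>J\<close> of common denominators of all powers of \<open>x\<close> is nonzero and satisfies \<open>J x \<subseteq> J\<close>;
    being principal, this forces \<open>x\<close> to be an element of the ring.\<close>
  define J where "J = {b \<in> zsqrt2. \<forall>k. b * x ^ k \<in> zsqrt2}"
  \<comment> \<open>For \<open>k < n\<close> there are enough factors \<open>d\<close> to clear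
    every factor \<open>x\<close>; from \<open>n\<close> on, the monic equation rewrites x^k by
    lower powers.\<close>
  have "d ^ n * x ^ k \<in> zsqrt2" for k
  proof (induction k rule: less_induct)
    case (less k)
    show ?case
    proof (cases "k < n")
      case True
      then have "d ^ n * x ^ k = d ^ (n - k) * (d * x) ^ k"
        by (simp add: power_mult_distrib flip: mult.assoc power_add)
      then show ?thesis using d by auto
    next
      case False
      then have "d ^ n * x ^ k = d ^ n * x ^ (k - n) * x ^ n"
        by (simp flip: mult.assoc power_add)
      also have "\<dots> = - (\<Sum>i<n. coeff p i * (d ^ n * x ^ (k - n + i)))"
        unfolding xn by (simp add: sum_distrib_left power_add mult_ac)
      also have "\<dots> \<in> zsqrt2"
      proof (rule zsqrt2_minus, rule zsqrt2_sum, rule zsqrt2_mult)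
        fix i assume "i \<in> {..<n}"
        then show "d ^ n * x ^ (k - n + i) \<in> zsqrt2" using False by (intro less) auto
        show "coeff p i \<in> zsqrt2" using p(2)[of i] by (auto elim: Ints_cases)
      qed
      finally show ?thesis .
    qed
  qed
  then have dJ: "d ^ n \<in> J" unfolding J_def using d by auto
  obtain g where g: "g \<in> J" "g \<noteq> 0" "J = {g * y | y. y \<in> zsqrt2}"
  proof (rule zsqrt2_principal[of J "d ^ n"])
    show "u + v \<in> J" if "u \<in> J" "v \<in> J" for u v
      using that by (auto simp: J_def distrib_right)
    show "u * v \<in> J" if "u \<in> zsqrt2" "v \<in> J" for u v
      using that by (auto simp: J_def mult.assoc)
  qed (use dJ d in \<open>auto simp: J_def\<close>)
  have "g * x \<in> J"
    using g(1) unfolding J_def by (auto simp: mult.assoc simp flip: power_Suc dest: spec[of _ 1])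
  then obtain y where "g * x = g * y" "y \<in> zsqrt2" unfolding g(3) by blast
  then show ?thesis using g(2) by simp
qed

text \<open>The remaining inclusion holds because x + y sqrt 2 is a root of its characteristic
  polynomial X^2 - 2 x X + (x^2 - 2 y^2).\<close>

lemma integers_of_Q_sqrt2: "integers_of Q_sqrt2 = zsqrt2"
proof (intro equalityI subsetI)
  fix z assume "z \<in> integers_of Q_sqrt2"
  then show "z \<in> zsqrt2" unfolding integers_of_def using zsqrt2_integrally_closed by blast
next
  fix z assume z: "z \<in> zsqrt2"
  then obtain x y where xy: "z = quad (of_int x) (of_int y)" by (rule zsqrt2_E)
  define c where "c = complex_of_int (x\<^sup>2 - 2 * y\<^sup>2)"
  have "poly [:c, - 2 * of_int x, 1:] z = 0"
  proof -
    have "poly [:c, - 2 * of_int x, 1:] z = c + z * (z - 2 * of_int x)"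
      by (simp add: algebra_simps)
    also have "z - 2 * of_int x = quad (- of_int x) (of_int y)"
      by (simp add: xy quad_def of_rat_minus)
    also have "z * \<dots> = quad (- (of_int x * of_int x) + 2 * (of_int y * of_int y)) 0"
      by (simp add: xy quad_mult)
    also have "c + \<dots> = 0"
      by (simp add: quad_rat c_def of_rat_diff of_rat_mult power2_eq_square)
    finally show ?thesis .
  qed
  moreover have "\<forall>i. coeff [:c, - 2 * of_int x, 1:] i \<in> \<int>"
    by (auto simp: coeff_pCons c_def split: nat.splits)
  ultimately have "algebraic_int z" by (intro algebraic_int.intros) auto
  then show "z \<in> integers_of Q_sqrt2"
    unfolding integers_of_def using z zsqrt2_subset by blast
qed

section \<open>Prime ideals\<close>

lemma int_ring_simps [simp]:
  "carrier (int_ring K) = integers_of K" "\<one>\<^bsub>int_ring K\<^esub> = 1" "\<zero>\<^bsub>int_ring K\<^esub> = 0"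
  "x \<otimes>\<^bsub>int_ring K\<^esub> y = x * y" "x \<oplus>\<^bsub>int_ring K\<^esub> y = x + y"
  by (simp_all add: ring_of_type_algebra_def)

text \<open>The locale restates the ideal axioms as plain facts about sets of complex numbers, so
  that later arguments need no ring structure.\<close>

locale zsqrt2_prime_ideal =
  fixes P :: "complex set"
  assumes prime_ideal: "P \<in> prime_ideals Q_sqrt2"
begin

lemma primeideal: "primeideal P (int_ring Q_sqrt2)"
  using prime_ideal unfolding prime_ideals_def by blast

lemma subset: "P \<subseteq> zsqrt2"
proof -
  interpret primeideal P "int_ring Q_sqrt2" by (rule primeideal)
  show ?thesis using a_subset by (simp add: integers_of_Q_sqrt2)
qed

lemma zero: "0 \<in> P"
proof -
  interpret primeideal P "int_ring Q_sqrt2" by (rule primeideal)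
  show ?thesis using additive_subgroup.zero_closed[OF additive_subgroup_axioms] by simp
qed

lemma add: "x \<in> P \<Longrightarrow> y \<in> P \<Longrightarrow> x + y \<in> P"
proof -
  interpret primeideal P "int_ring Q_sqrt2" by (rule primeideal)
  show "x \<in> P \<Longrightarrow> y \<in> P \<Longrightarrow> x + y \<in> P" 
    using additive_subgroup.a_closed[OF additive_subgroup_axioms, of x y] by simp
qed

lemma mult: "x \<in> zsqrt2 \<Longrightarrow> y \<in> P \<Longrightarrow> x * y \<in> P"
proof -
  interpret primeideal P "int_ring Q_sqrt2" by (rule primeideal)
  show "x \<in> zsqrt2 \<Longrightarrow> y \<in> P \<Longrightarrow> x * y \<in> P"
    using I_l_closed[of y x] by (simp add: integers_of_Q_sqrt2)
qed

lemma prime: "x \<in> zsqrt2 \<Longrightarrow> y \<in> zsqrt2 \<Longrightarrow> x * y \<in> P \<Longrightarrow> x \<in> P \<or> y \<in> P"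
proof -
  interpret primeideal P "int_ring Q_sqrt2" by (rule primeideal)
  show "x \<in> zsqrt2 \<Longrightarrow> y \<in> zsqrt2 \<Longrightarrow> x * y \<in> P \<Longrightarrow> x \<in> P \<or> y \<in> P"
    using I_prime[of x y] by (simp add: integers_of_Q_sqrt2)
qed

lemma one_notin: "1 \<notin> P"
proof
  assume "1 \<in> P"
  then have "zsqrt2 \<subseteq> P" using mult[of _ 1] by auto
  moreover interpret primeideal P "int_ring Q_sqrt2" by (rule primeideal)
  have "P \<noteq> zsqrt2" using I_notcarr by (simp add: integers_of_Q_sqrt2)
  ultimately show False using subset by blast
qed

lemma minus: "x \<in> P \<Longrightarrow> - x \<in> P"
  using mult[OF zsqrt2_of_int[of "- 1"]] by simp

lemma unit_notin: "u * v = 1 \<Longrightarrow> v \<in> zsqrt2 \<Longrightarrow> u \<notin> P"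
  using mult[of v u] one_notin by (metis mult.commute)

section \<open>A generator and the valuation it defines\<close>

definition \<pi> :: complex where
  "\<pi> = (SOME g. g \<in> P \<and> g \<noteq> 0 \<and> P = {g * y | y. y \<in> zsqrt2})"

lemma generator: "\<pi> \<in> P" "\<pi> \<noteq> 0" "P = {\<pi> * y | y. y \<in> zsqrt2}"
proof -
  have "P \<noteq> {0}" using prime_ideal unfolding prime_ideals_def by blast
  then obtain b where b: "b \<in> P" "b \<noteq> 0" using zero by blast
  obtain g where g: "g \<in> P" "g \<noteq> 0" "P = {g * y | y. y \<in> zsqrt2}"
    by (rule zsqrt2_principal[OF subset b add mult])
  then have "g \<in> P \<and> g \<noteq> 0 \<and> P = {g * y | y. y \<in> zsqrt2}" by (intro conjI)
  from someI[of "\<lambda>g. g \<in> P \<and> g \<noteq> 0 \<and> P = {g * y | y. y \<in> zsqrt2}" g, OF this] show "\<pi> \<in> P" "\<pi> \<noteq> 0" "P = {\<pi> * y | y. y \<in> zsqrt2}"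
    unfolding \<pi>_def by blast+
qed

lemma generator_mult: "y \<in> zsqrt2 \<Longrightarrow> \<pi> * y \<in> P"
  by (subst generator(3)) blast

lemma pi_zsqrt2: "\<pi> \<in> zsqrt2"
  using generator(1) subset by blast

text \<open>A product of principal ideals is generated by the product of the generators. The
  valuation thereby becomes a question about divisibility by powers of \<open>\<pi>\<close>.\<close>

lemma ideal_power: "P [^]\<^bsub>ideals_set (int_ring Q_sqrt2)\<^esub> (n::nat) = {\<pi> ^ n * y | y. y \<in> zsqrt2}"
proof (induction n)
  case 0
  show ?case by (simp add: nat_pow_def ideals_set_def integers_of_Q_sqrt2)
next
  case (Suc n)
  let ?A = "{\<pi> ^ n * y | y. y \<in> zsqrt2}"
  have "P [^]\<^bsub>ideals_set (int_ring Q_sqrt2)\<^esub> Suc n = ideal_prod (int_ring Q_sqrt2) ?A P"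
    using Suc by (simp add: nat_pow_def ideals_set_def)
  also have "\<dots> = {\<pi> ^ Suc n * y | y. y \<in> zsqrt2}"
  proof (intro equalityI subsetI)
    fix z assume "z \<in> ideal_prod (int_ring Q_sqrt2) ?A P"
    then show "z \<in> {\<pi> ^ Suc n * y | y. y \<in> zsqrt2}"
    proof (induction rule: ideal_prod.induct)
      case (prod i j)
      then obtain u v where "i = \<pi> ^ n * u" "j = \<pi> * v" and uv: "u \<in> zsqrt2" "v \<in> zsqrt2"
        using generator(3) by blast
      then have "i * j = \<pi> ^ Suc n * (u * v)" by simp
      then show ?case using uv zsqrt2_mult by auto
    next
      case (sum s1 s2)
      then obtain u v where "s1 = \<pi> ^ Suc n * u" "s2 = \<pi> ^ Suc n * v" and uv: "u \<in> zsqrt2" "v \<in> zsqrt2"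
        by blast
      then have "s1 + s2 = \<pi> ^ Suc n * (u + v)" by (simp add: distrib_left)
      then show ?case using uv zsqrt2_add by auto
    qed
  next
    fix z assume "z \<in> {\<pi> ^ Suc n * y | y. y \<in> zsqrt2}"
    then obtain y where "z = \<pi> ^ Suc n * y" "y \<in> zsqrt2" by blast
    then have y: "z = \<pi> ^ n * y * \<pi>" "y \<in> zsqrt2" by simp_all
    then show "z \<in> ideal_prod (int_ring Q_sqrt2) ?A P"
      using ideal_prod.prod[of "\<pi> ^ n * y" ?A \<pi> P "int_ring Q_sqrt2"] generator(1) by auto
  qed
  finally show ?case .
qed

text \<open>The exact order as a relation with an explicit cofactor outside \<open>P\<close>. It is
  additive by primality of \<open>P\<close> and gives the value of the \<open>GREATEST\<close> in
  \<open>int_valuation\<close>.\<close>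

definition has_order :: "complex \<Rightarrow> nat \<Rightarrow> bool" where
  "has_order a n \<longleftrightarrow> (\<exists>u. u \<in> zsqrt2 \<and> u \<notin> P \<and> a = \<pi> ^ n * u)"

lemma power_dvd_iff:
  assumes "has_order a n"
  shows "a \<in> {\<pi> ^ k * y | y. y \<in> zsqrt2} \<longleftrightarrow> k \<le> n"
proof
  obtain u where u: "u \<in> zsqrt2" "u \<notin> P" "a = \<pi> ^ n * u"
    using assms unfolding has_order_def by blast
  show "k \<le> n" if dvd: "a \<in> {\<pi> ^ k * y | y. y \<in> zsqrt2}"
  proof (rule ccontr)
    assume "\<not> k \<le> n"
    then obtain j where j: "k = n + Suc j" using less_iff_Suc_add[of n k] by auto
    obtain y where y: "a = \<pi> ^ k * y" "y \<in> zsqrt2" using dvd by blast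
    then have "\<pi> ^ n * u = \<pi> ^ n * (\<pi> * (\<pi> ^ j * y))" using u by (simp add: j power_add)
    then have "u = \<pi> * (\<pi> ^ j * y)" using generator(2) by simp
    moreover have "\<pi> ^ j * y \<in> zsqrt2" using y pi_zsqrt2 by blast
    ultimately have "u \<in> P" using generator(3) by blast
    then show False using u by blast
  qed
  show "a \<in> {\<pi> ^ k * y | y. y \<in> zsqrt2}" if "k \<le> n"
  proof -
    have "a = \<pi> ^ k * (\<pi> ^ (n - k) * u)" using that u by (simp flip: mult.assoc power_add)
    moreover have "\<pi> ^ (n - k) * u \<in> zsqrt2" using u pi_zsqrt2 by blast
    ultimately show ?thesis by blast
  qed
qed

lemma int_valuation_eq:
  assumes "has_order a n"
  shows "int_valuation Q_sqrt2 P a = n"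
  unfolding int_valuation_def ideal_power power_dvd_iff[OF assms]
  by (rule Greatest_equality) auto

lemma has_order_mult:
  assumes "has_order a m" "has_order b n"
  shows "has_order (a * b) (m + n)"
proof -
  obtain u v where "u \<in> zsqrt2" "u \<notin> P" "a = \<pi> ^ m * u" "v \<in> zsqrt2" "v \<notin> P" "b = \<pi> ^ n * v"
    using assms unfolding has_order_def by blast
  then have "a * b = \<pi> ^ (m + n) * (u * v)" "u * v \<in> zsqrt2" "u * v \<notin> P"
    using prime by (auto simp: power_add)
  then show ?thesis unfolding has_order_def by blast
qed

text \<open>If the norm k were 1 or -1, then k times the conjugate would be an inverse of
  \<open>\<pi>\<close>, but \<open>P\<close> contains no unit.\<close>

lemma qnorm_pi: "\<bar>qnorm \<pi>\<bar> \<ge> 2"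
proof -
  obtain x y where xy: "\<pi> = quad (of_int x) (of_int y)" using pi_zsqrt2 by (rule zsqrt2_E)
  define k where "k = x\<^sup>2 - 2 * y\<^sup>2"
  have k: "qnorm \<pi> = of_int k" by (simp add: xy k_def)
  have ge1: "\<bar>k\<bar> \<ge> 1"
    using qnorm_abs_ge_1[OF pi_zsqrt2 generator(2)] unfolding k by (simp flip: of_int_abs)
  have "\<bar>k\<bar> \<noteq> 1"
  proof
    assume "\<bar>k\<bar> = 1"
    have "\<pi> * quad (of_int x) (of_int (- y)) = quad (of_int k) 0"
      by (simp add: xy quad_mult k_def power2_eq_square)
    also have "\<dots> = of_int k" by (simp add: quad_rat)
    finally have eq: "\<pi> * quad (of_int x) (of_int (- y)) = of_int k" .
    have "k * k = 1" using \<open>\<bar>k\<bar> = 1\<close> by (auto simp: abs_if split: if_splits)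
    then have "\<pi> * (quad (of_int x) (of_int (- y)) * of_int k) = 1"
      unfolding mult.assoc[symmetric] eq by (simp flip: of_int_mult)
    then show False
      using unit_notin[of \<pi> "quad (of_int x) (of_int (- y)) * of_int k"] generator(1) zsqrt2_I[of x "- y"]
        zsqrt2_of_int[of k] zsqrt2_mult by blast
  qed
  then have "\<bar>k\<bar> \<ge> 2" using ge1 by linarith
  then show ?thesis unfolding k by (simp flip: of_int_abs)
qed

text \<open>Dividing by \<open>\<pi>\<close> at least halves the absolute norm, so the division
  stops.\<close>

lemma has_order_exists:
  assumes "a \<in> zsqrt2" "a \<noteq> 0"
  obtains n where "has_order a n"
proof -
  define m where "m z = nat \<lfloor>\<bar>qnorm z\<bar>\<rfloor>" for z
  have "\<exists>n. has_order a n" using assms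
  proof (induction a rule: measure_induct_rule[of m])
    case (less a)
    show ?case
    proof (cases "a \<in> P")
      case False
      then have "has_order a 0" using less unfolding has_order_def by simp
      then show ?thesis by blast
    next
      case True
      then obtain b where b: "a = \<pi> * b" "b \<in> zsqrt2" using generator(3) by blast
      then have b0: "b \<noteq> 0" using less by auto
      obtain k where k: "qnorm b = of_int k" using b(2) by (rule qnorm_zsqrt2)
      obtain l where l: "qnorm a = of_int l" using less(2) by (rule qnorm_zsqrt2)
      have "2 * \<bar>qnorm b\<bar> \<le> \<bar>qnorm \<pi>\<bar> * \<bar>qnorm b\<bar>"
        using qnorm_pi by (intro mult_right_mono) auto
      also have "\<dots> = \<bar>qnorm a\<bar>"
        unfolding b(1) using qnorm_mult[of \<pi> b] b(2) pi_zsqrt2 zsqrt2_subset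
        by (simp add: abs_mult subsetD)
      finally have "2 * \<bar>qnorm b\<bar> \<le> \<bar>qnorm a\<bar>" .
      then have "2 * \<bar>k\<bar> \<le> \<bar>l\<bar>" unfolding k l by linarith
      moreover have "\<bar>k\<bar> \<ge> 1"
        using qnorm_abs_ge_1[OF b(2) b0] unfolding k by (simp flip: of_int_abs)
      ultimately have "m b < m a" unfolding m_def k l by (simp flip: of_int_abs)
      then obtain n where "has_order b n" using less(1) b(2) b0 by blast
      then obtain u where "u \<in> zsqrt2" "u \<notin> P" "b = \<pi> ^ n * u" unfolding has_order_def by blast
      then have "has_order a (Suc n)" unfolding has_order_def using b(1) by auto
      then show ?thesis by blast
    qed
  qed
  then show ?thesis using that by blast
qed

lemma int_valuation_mult:
  assumes "a \<in> zsqrt2" "a \<noteq> 0" "b \<in> zsqrt2" "b \<noteq> 0"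
  shows "int_valuation Q_sqrt2 P (a * b) = int_valuation Q_sqrt2 P a + int_valuation Q_sqrt2 P b"
proof -
  obtain m n where "has_order a m" "has_order b n"
    using assms has_order_exists by metis
  then show ?thesis using int_valuation_eq has_order_mult by metis
qed

lemma int_valuation_eq_0: "a \<in> zsqrt2 \<Longrightarrow> a \<notin> P \<Longrightarrow> int_valuation Q_sqrt2 P a = 0"
  by (rule int_valuation_eq) (simp add: has_order_def)

text \<open>The fraction \<open>a / 1\<close> provides the value, and by additivity every other
  fraction gives the same one, as \<open>THE\<close> requires.\<close>

lemma valuation_zsqrt2:
  assumes "a \<in> zsqrt2" "a \<noteq> 0"
  shows "valuation Q_sqrt2 P a = int (int_valuation Q_sqrt2 P a)"
  unfolding valuation_def integers_of_Q_sqrt2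
proof (rule the_equality)
  have "int_valuation Q_sqrt2 P 1 = 0" using int_valuation_eq_0[of 1] one_notin by simp
  then show "\<exists>x\<in>zsqrt2 - {0}. \<exists>b\<in>zsqrt2 - {0}. a = x / b \<and>
      int (int_valuation Q_sqrt2 P a) = int (int_valuation Q_sqrt2 P x) - int (int_valuation Q_sqrt2 P b)"
    using assms by (intro bexI[of _ a] bexI[of _ 1]) auto
next
  fix k assume "\<exists>x\<in>zsqrt2 - {0}. \<exists>b\<in>zsqrt2 - {0}. a = x / b \<and>
      k = int (int_valuation Q_sqrt2 P x) - int (int_valuation Q_sqrt2 P b)"
  then obtain x b where xb: "x \<in> zsqrt2" "x \<noteq> 0" "b \<in> zsqrt2" "b \<noteq> 0" "a = x / b"
    and k: "k = int (int_valuation Q_sqrt2 P x) - int (int_valuation Q_sqrt2 P b)" by blast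
  have "x = a * b" using xb by simp
  then show "k = int (int_valuation Q_sqrt2 P a)"
    using int_valuation_mult[of a b] assms xb k by simp
qed

lemma valuation_unit:
  assumes "a \<in> zsqrt2" "a * b = 1" "b \<in> zsqrt2"
  shows "valuation Q_sqrt2 P a = 0"
proof -
  have "a \<notin> P" "a \<noteq> 0" using unit_notin assms by auto
  then show ?thesis using assms valuation_zsqrt2[of a] int_valuation_eq_0[of a] by auto
qed

section \<open>Absolute norm and residue characteristic of a prime ideal\<close>

lemma abs_norm_bounds: "abs_norm Q_sqrt2 P \<ge> 1" "of_nat (abs_norm Q_sqrt2 P) \<le> \<bar>qnorm \<pi>\<bar>"
proof -
  obtain x y where xy: "\<pi> = quad (of_int x) (of_int y)" using pi_zsqrt2 by (rule zsqrt2_E)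
  \<comment> \<open>\<open>P\<close> contains \<open>M\<close> and \<open>h + g\<surd>2\<close> with \<open>M g = |N|\<close> (its Hermite normal form), so the residues
    \<open>i + j\<surd>2\<close> with \<open>0 \<le> i < M\<close> and \<open>0 \<le> j < g\<close> represent all classes.\<close>
  define N where "N = x\<^sup>2 - 2 * y\<^sup>2"
  define g where "g = gcd x y"
  define M where "M = \<bar>N\<bar> div g"
  have "N \<noteq> 0" using qnorm_pi by (auto simp: xy N_def simp flip: of_int_power of_int_mult of_int_diff)
  then have "x \<noteq> 0 \<or> y \<noteq> 0" by (auto simp: N_def)
  then have g: "g > 0" by (auto simp: g_def)
  obtain x' y' where x': "x = g * x'" and y': "y = g * y'"
    unfolding g_def by (meson dvdE gcd_dvd1 gcd_dvd2)
  have N': "N = g * (x * x' - 2 * y * y')"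
    by (simp add: N_def power2_eq_square right_diff_distrib) (metis mult.assoc mult.commute x' y')
  have Mg: "M * g = \<bar>N\<bar>" using N' by (simp add: M_def)
  have M: "M > 0" using Mg \<open>N \<noteq> 0\<close> g by (metis abs_ge_zero zero_less_abs_iff zero_less_mult_pos2)
  \<comment> \<open>Up to sign, \<open>M\<close> is \<open>\<pi>\<close> times its conjugate divided
    by the content \<open>g\<close>.\<close>
  have MP: "of_int M \<in> P"
  proof -
    have eq: "\<pi> * quad (of_int x') (of_int (- y')) = of_int (x * x' - 2 * y * y')"
    proof -
      have "x * y' = y * x'" using x' y' by simp
      then have "of_int x * of_int y' = (of_int y * of_int x' :: rat)" by (simp flip: of_int_mult)
      then have "\<pi> * quad (of_int x') (of_int (- y')) = quad (of_int (x * x' - 2 * y * y')) 0"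
        by (simp add: xy quad_mult)
      also have "\<dots> = of_int (x * x' - 2 * y * y')" unfolding quad_rat by (rule of_rat_of_int_eq)
      finally show ?thesis .
    qed
    have *: "of_int (x * x' - 2 * y * y') \<in> P"
      unfolding eq[symmetric] by (rule generator_mult[OF zsqrt2_I])
    have "M = \<bar>x * x' - 2 * y * y'\<bar>" using g N' by (simp add: M_def abs_mult)
    then show ?thesis using * minus[OF *] by (auto simp: abs_if)
  qed
  \<comment> \<open>Bezout, because x t + y s is the coefficient of sqrt 2 in the product of
    \<open>\<pi>\<close> with s + t sqrt 2.\<close>
  obtain s t where st: "x * t + y * s = g"
    unfolding g_def using bezout_int[of x y] by (metis mult.commute)
  define h where "h = x * s + 2 * y * t"
  have hP: "quad (of_int h) (of_int g) \<in> P"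
  proof -
    have "\<pi> * quad (of_int s) (of_int t) = quad (of_int h) (of_int g)"
      by (simp add: xy quad_mult h_def flip: st)
    then show ?thesis using generator_mult[OF zsqrt2_I[of s t]] by simp
  qed
  define cos where "cos a = {p + a | p. p \<in> P}" for a
  have cos_eq: "cos a = cos b" if ab: "a - b \<in> P" for a b
  proof -
    have "cos a \<subseteq> cos b" if "a - b \<in> P" for a b
    proof
      fix z assume "z \<in> cos a"
      then obtain p where "p \<in> P" "z = p + a" unfolding cos_def by blast
      then have "z = (p + (a - b)) + b" "p + (a - b) \<in> P" using that add by auto
      then show "z \<in> cos b" unfolding cos_def by blast
    qed
    then show ?thesis using ab minus[OF ab] by (intro equalityI) auto
  qed
  have carr: "carrier (int_ring Q_sqrt2 Quot P) = cos ` zsqrt2"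
    by (auto simp: FactRing_def A_RCOSETS_def' a_r_coset_def' integers_of_Q_sqrt2 cos_def)
  define f where "f = (\<lambda>(i, j). cos (quad (of_int i) (of_int j)))"
  have "cos ` zsqrt2 \<subseteq> f ` ({0..<M} \<times> {0..<g})"
  proof
    fix C assume "C \<in> cos ` zsqrt2"
    then obtain u v where C: "C = cos (quad (of_int u) (of_int v))" by (auto elim: zsqrt2_E)
    \<comment> \<open>Reducing \<open>v\<close> modulo \<open>g\<close> subtracts a multiple of h +
      g sqrt 2, which shifts the first coordinate to \<open>u'\<close>; that one is then reduced
      modulo \<open>M\<close>.\<close>
    define u' where "u' = u - (v div g) * h"
    have "quad (of_int u) (of_int v) - quad (of_int (u' mod M)) (of_int (v mod g)) =
        of_int (v div g) * quad (of_int h) (of_int g) + of_int (u' div M) * of_int M"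
    proof -
      have v: "v - v mod g = v div g * g" by (simp add: minus_mod_eq_div_mult)
      have u: "u - u' mod M = (v div g) * h + (u' div M) * M"
        using minus_mod_eq_div_mult[of u' M] by (simp add: u'_def)
      have i: "(of_int k :: complex) = quad (of_int k) 0" for k by (simp add: quad_rat)
      show ?thesis unfolding i quad_diff of_int_diff[symmetric] u v
        by (simp add: quad_mult quad_add)
    qed
    also have "\<dots> \<in> P" using hP MP by (intro add mult) auto
    finally have "C = f (u' mod M, v mod g)" unfolding C f_def by (simp add: cos_eq)
    then show "C \<in> f ` ({0..<M} \<times> {0..<g})" using M g by auto
  qed
  then have sub: "carrier (int_ring Q_sqrt2 Quot P) \<subseteq> f ` ({0..<M} \<times> {0..<g})" using carr by simp
  have "abs_norm Q_sqrt2 P \<le> card (f ` ({0..<M} \<times> {0..<g}))"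
    unfolding abs_norm_def by (rule card_mono[OF _ sub]) auto
  also have "\<dots> \<le> card ({0..<M} \<times> {0..<g})" by (rule card_image_le) auto
  also have "\<dots> = nat \<bar>N\<bar>" using M g by (simp add: Mg flip: nat_mult_distrib)
  finally have "int (abs_norm Q_sqrt2 P) \<le> \<bar>N\<bar>" by simp
  then have "(of_nat (abs_norm Q_sqrt2 P) :: rat) \<le> of_int \<bar>N\<bar>"
    by (metis of_int_le_iff of_int_of_nat_eq)
  also have "of_int \<bar>N\<bar> = \<bar>qnorm \<pi>\<bar>" by (simp add: xy N_def)
  finally show "of_nat (abs_norm Q_sqrt2 P) \<le> \<bar>qnorm \<pi>\<bar>" .
  \<comment> \<open>Finiteness matters: \<open>card\<close> of an infinite quotient would be
    0.\<close>
  have "finite (carrier (int_ring Q_sqrt2 Quot P))" using sub by (rule finite_subset) auto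
  moreover have "cos 0 \<in> carrier (int_ring Q_sqrt2 Quot P)" unfolding carr by simp
  ultimately show "abs_norm Q_sqrt2 P \<ge> 1"
    unfolding abs_norm_def by (metis One_nat_def Suc_leI card_gt_0_iff empty_iff)
qed

text \<open>\<open>P\<close> contains the norm of \<open>\<pi>\<close>, a nonzero integer, and by
  primality one of its prime factors p. By Bezout an integer in \<open>P\<close> not divisible by p
  would put 1 into \<open>P\<close>; so \<open>P\<close> meets the integers exactly in the multiples
  of p.\<close>

lemma residue_char:
  "Factorial_Ring.prime (residue_char P)" "of_int z \<in> P \<longleftrightarrow> int (residue_char P) dvd z"
proof -
  obtain x y where xy: "\<pi> = quad (of_int x) (of_int y)" using pi_zsqrt2 by (rule zsqrt2_E)
  have int_mult: "of_int (a * b) \<in> P" if "of_int a \<in> P" for a b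
    using mult[of "of_int b" "of_int a"] that by (simp add: mult.commute)
  have "\<exists>p. Factorial_Ring.prime p \<and> of_int (int p) \<in> P"
  proof -
    define k where "k = x\<^sup>2 - 2 * y\<^sup>2"
    have "\<pi> * quad (of_int x) (of_int (- y)) = quad (of_int k) 0"
      by (simp add: xy quad_mult k_def power2_eq_square)
    also have "\<dots> = of_int k" by (simp add: quad_rat)
    finally have "of_int k = \<pi> * quad (of_int x) (of_int (- y))" ..
    then have kP: "of_int k \<in> P" by (simp only: generator_mult[OF zsqrt2_I])
    have "k \<noteq> 0" using qnorm_pi by (auto simp: xy k_def simp flip: of_int_power of_int_mult of_int_diff)
    have *: "n > 0 \<Longrightarrow> of_nat n \<in> P \<Longrightarrow> \<exists>p. Factorial_Ring.prime p \<and> of_int (int p) \<in> P" for n :: nat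
    proof (induction n rule: less_induct)
      case (less n)
      have "n \<noteq> 1" using less one_notin by auto
      then obtain p where p: "Factorial_Ring.prime p" "p dvd n" using prime_factor_nat by blast
      then obtain m where m: "n = p * m" by blast
      have "of_nat p \<in> P \<or> of_nat m \<in> P"
        using less(3) by (intro prime) (auto simp: m)
      then show ?case
      proof
        assume "of_nat p \<in> P"
        then show ?thesis using p by auto
      next
        assume "of_nat m \<in> P"
        moreover have "m > 0" "m < n" using less(2) m p prime_gt_1_nat[of p] by auto
        ultimately show ?thesis using less(1) by blast
      qed
    qed
    have "of_nat (nat \<bar>k\<bar>) \<in> P"
      using kP minus[OF kP] by (auto simp: of_nat_nat abs_if)
    then show ?thesis using *[of "nat \<bar>k\<bar>"] \<open>k \<noteq> 0\<close> by auto
  qed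
  then obtain p where p: "Factorial_Ring.prime p" "of_int (int p) \<in> P" by blast
  have iff: "of_int z \<in> P \<longleftrightarrow> int p dvd z" for z
  proof
    assume z: "of_int z \<in> P"
    show "int p dvd z"
    proof (rule ccontr)
      assume "\<not> int p dvd z"
      then have "coprime (int p) z" using p(1) by (intro prime_imp_coprime) auto
      then obtain u v where "u * int p + v * z = 1"
        using bezout_int[of "int p" z] by auto
      moreover have "of_int (int p * u) + of_int (z * v) \<in> P"
        by (intro add int_mult p(2) z)
      ultimately have "1 \<in> P" by (metis mult.commute of_int_1 of_int_add)
      then show False using one_notin by simp
    qed
  next
    assume "int p dvd z"
    then show "of_int z \<in> P" using int_mult p(2) by blast
  qed
  have "residue_char P = p"
    unfolding residue_char_def
  proof (rule the_equality)
    show "Factorial_Ring.prime p \<and> {z. of_int z \<in> P} = {z. int p dvd z}" using p iff by blast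
  next
    fix q assume q: "Factorial_Ring.prime q \<and> {z. of_int z \<in> P} = {z. int q dvd z}"
    have "{z. of_int z \<in> P} = {z. int p dvd z}" using iff by blast
    then have "{z. int p dvd z} = {z. int q dvd z}" using q by simp
    moreover have "int q \<in> {z. int q dvd z}" by simp
    ultimately have "int p dvd int q" by blast
    then show "q = p" using p q primes_dvd_imp_eq by auto
  qed
  then show "Factorial_Ring.prime (residue_char P)"
    "of_int z \<in> P \<longleftrightarrow> int (residue_char P) dvd z" using p iff by auto
qed

end

section \<open>Several prime ideals at once\<close>

text \<open>Otherwise \<open>P\<close> is contained in \<open>Q\<close> and the generator of
  \<open>P\<close> is that of \<open>Q\<close> times some x. As the generator of \<open>Q\<close> is
  not in \<open>P\<close>, x is; cancelling the generator of \<open>P\<close> makes that of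
  \<open>Q\<close> a unit.\<close>

lemma generator_notin_other_prime:
  assumes "P \<in> prime_ideals Q_sqrt2" "Q \<in> prime_ideals Q_sqrt2" "P \<noteq> Q"
  shows "zsqrt2_prime_ideal.\<pi> P \<notin> Q"
proof
  interpret P: zsqrt2_prime_ideal P by unfold_locales fact
  interpret Q: zsqrt2_prime_ideal Q by unfold_locales fact
  assume piQ: "P.\<pi> \<in> Q"
  then obtain x where x: "P.\<pi> = Q.\<pi> * x" "x \<in> zsqrt2" using Q.generator(3) by blast
  have "P \<subseteq> Q"
  proof
    fix z assume "z \<in> P"
    then obtain y where "z = P.\<pi> * y" "y \<in> zsqrt2" using P.generator(3) by blast
    then show "z \<in> Q" using Q.mult[OF _ piQ, of y] by (simp add: mult.commute)
  qed
  then have "\<not> Q \<subseteq> P" using assms(3) by blast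
  then obtain z where z: "z \<in> Q" "z \<notin> P" by blast
  then obtain w where "z = Q.\<pi> * w" "w \<in> zsqrt2" using Q.generator(3) by blast
  then have "Q.\<pi> \<notin> P" using P.mult[of w Q.\<pi>] z(2) by (auto simp: mult.commute)
  then have "x \<in> P" using P.prime[of Q.\<pi> x] Q.pi_zsqrt2 x P.generator(1) by auto
  then obtain y where y: "x = P.\<pi> * y" "y \<in> zsqrt2" using P.generator(3) by blast
  have "P.\<pi> * 1 = P.\<pi> * (Q.\<pi> * y)" using x y by simp
  then have "Q.\<pi> * y = 1" using P.generator(2) by (metis mult_left_cancel)
  then show False using Q.unit_notin y(2) Q.generator(1) by blast
qed

text \<open>Induction over the primes: splitting off the full power of the generator of
  \<open>P\<close> leaves the valuations at all other primes unchanged, and the norm of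
  \<open>P\<close> is at most the absolute norm of its generator.\<close>

lemma prod_abs_norm_le_qnorm:
  assumes "finite S" "S \<subseteq> prime_ideals Q_sqrt2" "a \<in> zsqrt2" "a \<noteq> 0"
  shows "(\<Prod>P\<in>S. of_nat (abs_norm Q_sqrt2 P) ^ int_valuation Q_sqrt2 P a) \<le> \<bar>qnorm a\<bar>"
  using assms
proof (induction S arbitrary: a rule: finite_induct)
  case empty
  then show ?case using qnorm_abs_ge_1 by simp
next
  case (insert P S)
  interpret P: zsqrt2_prime_ideal P using insert by unfold_locales auto
  obtain n where n: "P.has_order a n" using P.has_order_exists insert by metis
  then obtain u where u: "u \<in> zsqrt2" "a = P.\<pi> ^ n * u" unfolding P.has_order_def by blast
  then have u0: "u \<noteq> 0" using insert by auto
  have pn: "P.\<pi> ^ n \<in> zsqrt2" using P.pi_zsqrt2 by blast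
  have val: "int_valuation Q_sqrt2 Q a = int_valuation Q_sqrt2 Q u" if Q: "Q \<in> S" for Q
  proof -
    interpret Q: zsqrt2_prime_ideal Q using insert Q by unfold_locales auto
    have "P.\<pi> \<notin> Q" using insert Q by (intro generator_notin_other_prime) auto
    then have "P.\<pi> ^ k \<notin> Q" for k
      using Q.prime[of P.\<pi>] Q.one_notin P.pi_zsqrt2 by (induction k) auto
    then have "int_valuation Q_sqrt2 Q (P.\<pi> ^ n) = 0" using pn by (intro Q.int_valuation_eq_0)
    then show ?thesis
      unfolding u(2) using Q.int_valuation_mult[of "P.\<pi> ^ n" u] pn u u0 P.generator(2) by simp
  qed
  have qp: "qnorm (P.\<pi> ^ k) = qnorm P.\<pi> ^ k" for k
  proof (induction k)
    case 0
    have "qnorm 1 = 1" using qnorm_quad[of 1 0] by (simp add: quad_rat)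
    then show ?case by simp
  next
    case (Suc k)
    then show ?case
      using qnorm_mult[of P.\<pi> "P.\<pi> ^ k"] P.pi_zsqrt2 zsqrt2_subset zsqrt2_power by auto
  qed
  have "(\<Prod>Q\<in>insert P S. of_nat (abs_norm Q_sqrt2 Q) ^ int_valuation Q_sqrt2 Q a) =
      of_nat (abs_norm Q_sqrt2 P) ^ n * (\<Prod>Q\<in>S. of_nat (abs_norm Q_sqrt2 Q) ^ int_valuation Q_sqrt2 Q u)"
    using insert P.int_valuation_eq[OF n] val by (simp cong: prod.cong)
  also have "\<dots> \<le> \<bar>qnorm P.\<pi>\<bar> ^ n * \<bar>qnorm u\<bar>"
    using insert u u0 P.abs_norm_bounds by (intro mult_mono power_mono insert.IH prod_nonneg) auto
  also have "\<dots> = \<bar>qnorm a\<bar>"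
    unfolding u(2) using qnorm_mult[of "P.\<pi> ^ n" u] pn u(1) zsqrt2_subset
    by (simp add: abs_mult power_abs qp subsetD)
  finally show ?case .
qed

section \<open>Heights and radicals\<close>

definition id_embedding :: "complex \<Rightarrow> complex" where
  "id_embedding = (\<lambda>z\<in>Q_sqrt2. z)"

definition sqrt2_conj :: "complex \<Rightarrow> complex" where
  "sqrt2_conj = (\<lambda>z\<in>Q_sqrt2. THE w. \<exists>a b. z = quad a b \<and> w = quad a (- b))"

lemma id_embedding_quad [simp]: "id_embedding (quad a b) = quad a b"
  by (simp add: id_embedding_def)

lemma sqrt2_conj_quad [simp]: "sqrt2_conj (quad a b) = quad a (- b)"
proof -
  have "(THE w. \<exists>c d. quad a b = quad c d \<and> w = quad c (- d)) = quad a (- b)"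
    by (rule the_equality) auto
  then show ?thesis by (simp add: sqrt2_conj_def)
qed

lemma quad_real: "quad a b \<in> \<real>"
  by (simp add: quad_def of_rat_complex)

text \<open>A homomorphism fixes the rationals and sends the square root of 2 to one of the two
  roots of X^2 = 2; extensionality fixes it outside the field.\<close>

lemma embeddings_Q_sqrt2: "embeddings Q_sqrt2 = {id_embedding, sqrt2_conj}"
proof (intro equalityI subsetI)
  fix \<rho> assume \<rho>: "\<rho> \<in> embeddings Q_sqrt2"
  then have ext: "\<rho> \<in> extensional Q_sqrt2" and hom: "\<rho> \<in> ring_hom (subring_of Q_sqrt2) complex_field"
    unfolding embeddings_def by auto
  have add: "\<rho> (x + y) = \<rho> x + \<rho> y" if "x \<in> Q_sqrt2" "y \<in> Q_sqrt2" for x y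
    using ring_hom_add[OF hom, of x y] that by simp
  have mult: "\<rho> (x * y) = \<rho> x * \<rho> y" if "x \<in> Q_sqrt2" "y \<in> Q_sqrt2" for x y
    using ring_hom_mult[OF hom, of x y] that by simp
  have one: "\<rho> 1 = 1"
    using ring_hom_one[OF hom] by simp
  have ratK: "of_rat q \<in> Q_sqrt2" for q
    using quad_in_Q_sqrt2[of q 0] by (simp add: quad_rat)
  have oneK: "1 \<in> Q_sqrt2" and zeroK: "0 \<in> Q_sqrt2"
    using ratK[of 1] ratK[of 0] by simp_all
  have zero: "\<rho> 0 = 0" using add[OF zeroK zeroK] by simp
  have nat: "\<rho> (of_nat n) = of_nat n" for n
  proof (induction n)
    case (Suc n)
    have "of_nat n \<in> Q_sqrt2" using ratK[of "of_nat n"] by simp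
    then show ?case using add[OF oneK, of "of_nat n"] Suc one by simp
  qed (use zero in simp)
  have int: "\<rho> (of_int k) = of_int k" for k
  proof (cases k rule: int_cases2)
    case (nonneg n)
    then show ?thesis using nat by simp
  next
    case (nonpos n)
    have "of_nat n \<in> Q_sqrt2" "- of_nat n \<in> Q_sqrt2"
      using ratK[of "of_nat n"] ratK[of "- of_nat n"] by (simp_all add: of_rat_minus)
    from add[OF this] have "of_nat n + \<rho> (- of_nat n) = 0" using nat zero by simp
    then show ?thesis using nonpos by (simp add: add_eq_0_iff)
  qed
  have rat: "\<rho> (of_rat q) = of_rat q" for q
  proof (cases q)
    case (Fract m n)
    then have q: "of_int n * (of_rat q :: complex) = of_int m" by (simp add: of_rat_rat)
    have "of_int n \<in> Q_sqrt2" using ratK[of "of_int n"] by simp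
    from mult[OF this ratK[of q]] have "of_int n * \<rho> (of_rat q) = of_int n * of_rat q"
      unfolding q int by (rule sym)
    moreover have "of_int n \<noteq> (0::complex)" using Fract(2) by simp
    ultimately show ?thesis by (metis mult_left_cancel)
  qed
  define s where "s = complex_of_real (sqrt 2)"
  have sK: "s \<in> Q_sqrt2" using zsqrt2_sqrt_2 zsqrt2_subset unfolding s_def by blast
  have s: "s * s = of_int 2" unfolding s_def by (simp add: sqrt_2_squared)
  have \<rho>q: "\<rho> (quad a b) = of_rat a + of_rat b * \<rho> s" for a b
  proof -
    have "of_rat b * s \<in> Q_sqrt2" using quad_in_Q_sqrt2[of 0 b] by (simp add: quad_def s_def)
    then show ?thesis
      unfolding quad_def s_def[symmetric] by (simp add: add mult ratK sK rat)
  qed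
  have "\<rho> s * \<rho> s = s * s" using mult[OF sK sK] int[of 2] unfolding s by simp
  then have "\<rho> s = s \<or> \<rho> s = - s" by (simp only: square_eq_iff)
  then show "\<rho> \<in> {id_embedding, sqrt2_conj}"
  proof
    assume \<rho>s: "\<rho> s = s"
    have "\<rho> = id_embedding"
    proof (rule extensionalityI[OF ext])
      show "\<rho> x = id_embedding x" if "x \<in> Q_sqrt2" for x
        using that by (elim Q_sqrt2_E) (simp add: \<rho>q \<rho>s, simp add: quad_def s_def)
    qed (simp add: id_embedding_def)
    then show ?thesis by simp
  next
    assume \<rho>s: "\<rho> s = - s"
    have "\<rho> = sqrt2_conj"
    proof (rule extensionalityI[OF ext])
      show "\<rho> x = sqrt2_conj x" if "x \<in> Q_sqrt2" for x
        using that by (elim Q_sqrt2_E) (simp add: \<rho>q \<rho>s, simp add: quad_def s_def of_rat_minus)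
    qed (simp add: sqrt2_conj_def)
    then show ?thesis by simp
  qed
next
  fix \<rho> assume "\<rho> \<in> {id_embedding, sqrt2_conj}"
  then show "\<rho> \<in> embeddings Q_sqrt2"
  proof (elim insertE emptyE)
    assume \<rho>: "\<rho> = id_embedding"
    have "id_embedding \<in> ring_hom (subring_of Q_sqrt2) complex_field"
      using quad_rat[of 1]
      by (intro ring_hom_memI) (auto simp: id_embedding_def elim!: Q_sqrt2_E simp: quad_mult quad_add Q_sqrt2_eq)
    then show ?thesis unfolding \<rho> embeddings_def by (simp add: id_embedding_def)
  next
    assume \<rho>: "\<rho> = sqrt2_conj"
    have "sqrt2_conj \<in> ring_hom (subring_of Q_sqrt2) complex_field"
      using sqrt2_conj_quad[of 1 0]
      by (intro ring_hom_memI) (auto elim!: Q_sqrt2_E simp: quad_mult quad_add quad_rat)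
    then show ?thesis unfolding \<rho> embeddings_def by (simp add: sqrt2_conj_def)
  qed
qed

text \<open>Both embeddings are real. Hence each infinite place is a singleton, the
  \<open>SOME\<close> in \<open>place_norm\<close> has only one choice, and the exponent there is
  1.\<close>

lemma conj_embedding_Q_sqrt2:
  assumes "\<rho> \<in> embeddings Q_sqrt2"
  shows "conj_embedding Q_sqrt2 \<rho> = \<rho>" "\<rho> ` Q_sqrt2 \<subseteq> \<real>"
proof -
  show real: "\<rho> ` Q_sqrt2 \<subseteq> \<real>"
    using assms unfolding embeddings_Q_sqrt2 by (auto elim!: Q_sqrt2_E simp: quad_real)
  have "\<rho> \<in> extensional Q_sqrt2" using assms unfolding embeddings_def by blast
  then show "conj_embedding Q_sqrt2 \<rho> = \<rho>"
    unfolding conj_embedding_def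
    by (intro extensionalityI[of _ Q_sqrt2]) (use real in \<open>auto simp: image_subset_iff Reals_cnj_iff\<close>)
qed

lemma places_Q_sqrt2:
  "places Q_sqrt2 = Finite_Place ` prime_ideals Q_sqrt2 \<union>
     {Infinite_Place {id_embedding}, Infinite_Place {sqrt2_conj}}"
  unfolding places_def using conj_embedding_Q_sqrt2 by (auto simp: embeddings_Q_sqrt2)

lemma place_norm_infinite:
  assumes "\<rho> \<in> embeddings Q_sqrt2"
  shows "place_norm Q_sqrt2 (Infinite_Place {\<rho>}) x = cmod (\<rho> x)"
  using conj_embedding_Q_sqrt2(2)[OF assms] by simp

lemma id_embedding_neq_sqrt2_conj: "id_embedding \<noteq> sqrt2_conj"
proof
  assume "id_embedding = sqrt2_conj"
  then have "id_embedding (quad 0 1) = sqrt2_conj (quad 0 1)" by simp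
  then show False by simp
qed

section \<open>The abc inequality for balancing numbers\<close>

lemma power_quad:
  "quad 3 2 ^ n = quad (of_int (lucas_balancing n)) (of_int (2 * balancing n))"
  "quad 3 (- 2) ^ n = quad (of_int (lucas_balancing n)) (of_int (- 2 * balancing n))"
proof -
  define s where "s = 2 * complex_of_real (sqrt 2)"
  have "s\<^sup>2 = 4 * (complex_of_real (sqrt 2) * complex_of_real (sqrt 2))"
    by (simp add: s_def power2_eq_square)
  then have s: "s\<^sup>2 = 8" "(- s)\<^sup>2 = 8" by (simp_all add: sqrt_2_squared)
  have "quad 3 2 = 3 + s" "quad 3 (- 2) = 3 + - s" by (simp_all add: quad_def s_def of_rat_minus)
  then show "quad 3 2 ^ n = quad (of_int (lucas_balancing n)) (of_int (2 * balancing n))"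
    "quad 3 (- 2) ^ n = quad (of_int (lucas_balancing n)) (of_int (- 2 * balancing n))"
    using power_eq_balancing[OF s(1), of n] power_eq_balancing[OF s(2), of n]
    by (simp_all add: quad_def s_def of_rat_mult of_rat_minus)
qed

lemma cmod_quad_3_2: "cmod (quad 3 2 ^ n) = \<alpha> ^ n"
proof -
  have "sqrt 8 = 2 * sqrt 2" using real_sqrt_mult[of 4 2] by simp
  then have "quad 3 2 = complex_of_real \<alpha>" by (simp add: quad_def)
  then have "cmod (quad 3 2) = \<alpha>" by (simp only: norm_of_real) simp
  then show ?thesis by (simp add: norm_power)
qed

definition radical_of :: "nat \<Rightarrow> nat" where
  "radical_of m = \<Prod>(prime_factors m)"

text \<open>At a prime of the radical the units \<open>a\<close> and \<open>b\<close> have valuation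
  0, so \<open>c\<close> lies in it; hence its residue characteristic p divides \<open>e\<close>,
  thus \<open>m\<close>, thus R = \<open>radical_of m\<close>. Each factor is then at most the norm
  of the prime to the valuation of R, and the product of these is at most the norm R^2 of R.\<close>

lemma radical_le:
  assumes c: "c \<in> zsqrt2" "c \<noteq> 0" and "m > 0"
    and units: "a \<in> zsqrt2" "a' \<in> zsqrt2" "a * a' = 1" "b \<in> zsqrt2" "b' \<in> zsqrt2" "b * b' = 1"
    and dvd: "d \<in> zsqrt2" "c * d = of_int e"
    and primes: "\<And>p. Factorial_Ring.prime p \<Longrightarrow> int p dvd e \<Longrightarrow> p dvd m"
  shows "radical Q_sqrt2 a b c \<le> (real (radical_of m))\<^sup>2" "radical Q_sqrt2 a b c \<ge> 0"
proof -
  show "radical Q_sqrt2 a b c \<ge> 0"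
    unfolding radical_def by (intro prod_nonneg) auto
  define R where "R = radical_of m"
  have R: "R > 0" unfolding R_def radical_of_def by (auto intro!: prod_pos simp: prime_factors_gt_0_nat)
  define S where "S = radical_primes Q_sqrt2 a b c"
  have S: "S \<subseteq> prime_ideals Q_sqrt2" unfolding S_def radical_primes_def by blast
  have cP: "c \<in> P" if "P \<in> S" for P
  proof (rule ccontr)
    assume nc: "c \<notin> P"
    interpret zsqrt2_prime_ideal P using that S by unfold_locales auto
    have "valuation Q_sqrt2 P a = 0" "valuation Q_sqrt2 P b = 0"
      using units valuation_unit by blast+
    moreover have "valuation Q_sqrt2 P c = 0"
      using valuation_zsqrt2[OF c] int_valuation_eq_0[OF c(1) nc] by simp
    ultimately show False using that unfolding S_def radical_primes_def by simp
  qed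
  have le: "real (abs_norm Q_sqrt2 P) powi valuation Q_sqrt2 P (of_nat (residue_char P)) \<le>
      real (abs_norm Q_sqrt2 P) ^ int_valuation Q_sqrt2 P (of_nat R)" if PS: "P \<in> S" for P
  proof -
    interpret zsqrt2_prime_ideal P using PS S by unfold_locales auto
    define p where "p = residue_char P"
    have p: "Factorial_Ring.prime p" using residue_char(1) by (simp add: p_def)
    have "of_int e \<in> P" using mult[OF dvd(1) cP[OF PS]] dvd(2) by (simp add: mult.commute)
    then have "p dvd m" using primes[OF p] residue_char(2) by (simp add: p_def)
    then have "p \<in> prime_factors m" using p \<open>m > 0\<close> by (simp add: in_prime_factors_iff)
    then have "p dvd R" unfolding R_def radical_of_def by (intro dvd_prod_eqI) auto
    then obtain k where k: "R = p * k" by blast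
    have pk: "p > 0" "k > 0" using R k by auto
    have "int_valuation Q_sqrt2 P (of_nat R) =
        int_valuation Q_sqrt2 P (of_nat p) + int_valuation Q_sqrt2 P (of_nat k)"
      unfolding k of_nat_mult using pk by (intro int_valuation_mult) auto
    moreover have "valuation Q_sqrt2 P (of_nat p) = int (int_valuation Q_sqrt2 P (of_nat p))"
      using pk by (intro valuation_zsqrt2) auto
    ultimately show ?thesis
      using abs_norm_bounds(1) unfolding p_def[symmetric] by (simp add: power_increasing)
  qed
  show "radical Q_sqrt2 a b c \<le> (real (radical_of m))\<^sup>2"
  proof (cases "finite S")
    \<comment> \<open>The library product over an infinite set is 1, which is at most R^2.\<close>
    case False
    then show ?thesis using R unfolding radical_def S_def R_def by simp
  next
    case True
    have "radical Q_sqrt2 a b c \<le> (\<Prod>P\<in>S. real (abs_norm Q_sqrt2 P) ^ int_valuation Q_sqrt2 P (of_nat R))"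
      unfolding radical_def S_def[symmetric] by (intro prod_mono conjI le) auto
    also have "\<dots> = of_rat (\<Prod>P\<in>S. of_nat (abs_norm Q_sqrt2 P) ^ int_valuation Q_sqrt2 P (of_nat R))"
      by (simp add: of_rat_prod of_rat_power)
    also have "\<dots> \<le> of_rat \<bar>qnorm (of_nat R)\<bar>"
      unfolding of_rat_less_eq using True S R by (intro prod_abs_norm_le_qnorm) auto
    also have "qnorm (of_nat R) = (of_nat R)\<^sup>2"
      using qnorm_quad[of "of_nat R" 0] by (simp add: quad_rat)
    also have "of_rat \<bar>(of_nat R)\<^sup>2\<bar> = (real R)\<^sup>2" by (simp add: of_rat_power)
    finally show ?thesis unfolding R_def .
  qed
qed

text \<open>The unit \<open>a\<close> has size \<open>\<alpha> ^ n\<close> under the identity and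
  the unit \<open>b\<close> has it under conjugation, so the height is at least the product of the
  two.\<close>

lemma abc_balancing:
  assumes abc: "abc_conjecture Q_sqrt2" and \<epsilon>: "\<epsilon> > 0"
  obtains C where "C > 0"
    "\<And>n. n > 0 \<Longrightarrow> \<alpha> ^ (2 * n) \<le> C * ((real (radical_of (2 * nat (balancing n))))\<^sup>2) powr (1 + \<epsilon>)"
proof -
  obtain C where C: "C > 0" and
    abcC: "\<And>a b c. a \<in> Q_sqrt2 - {0} \<Longrightarrow> b \<in> Q_sqrt2 - {0} \<Longrightarrow> c \<in> Q_sqrt2 - {0} \<Longrightarrow> a + b + c = 0 \<Longrightarrow>
      height Q_sqrt2 a b c \<le> C * radical Q_sqrt2 a b c powr (1 + \<epsilon>)"
    using abc \<epsilon> unfolding abc_conjecture_def by meson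
  show ?thesis
  proof (rule that[OF C])
    fix n :: nat assume n: "n > 0"
    define B L where "B = balancing n" and "L = lucas_balancing n"
    have B: "B > 0" using balancing_pos n by (simp add: B_def)
    \<comment> \<open>With \<beta> the conjugate of \<alpha>, these are the n-th power of \<alpha>,
      minus the n-th power of \<beta>, and -4 sqrt 2 B_n.\<close>
    define a b c where "a = quad (of_int L) (of_int (2 * B))"
      and "b = quad (of_int (- L)) (of_int (2 * B))" and "c = quad (of_int 0) (of_int (- 4 * B))"
    have abc0: "a + b + c = 0" by (simp add: a_def b_def c_def quad_add)
    have O: "a \<in> zsqrt2" "b \<in> zsqrt2" "c \<in> zsqrt2" unfolding a_def b_def c_def by (rule zsqrt2_I)+
    have ab: "a * - b = 1"
    proof -
      have "L * L - 8 * B * B = 1"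
        using lucas_balancing_norm[of n] by (simp add: B_def L_def power2_eq_square)
      then have "rat_of_int (L * L - 8 * B * B) = 1" by simp
      then show ?thesis by (simp add: a_def b_def quad_minus quad_mult)
    qed
    have ne: "a \<noteq> 0" "b \<noteq> 0" "c \<noteq> 0" using ab B by (auto simp: c_def)
    have units: "a * - b = 1" "b * - a = 1" "- a \<in> zsqrt2" "- b \<in> zsqrt2"
      using ab O by (auto simp: mult.commute)
    have a_pow: "a = quad 3 2 ^ n" and b_pow: "b = - (quad 3 (- 2) ^ n)"
      by (simp_all add: a_def b_def power_quad B_def L_def quad_minus)
    have alpha: "\<alpha> ^ n > 1" using n by (intro one_less_power) (auto simp: add_pos_nonneg intro!: add_strict_increasing)
    define m where "m v = Max {place_norm Q_sqrt2 v a, place_norm Q_sqrt2 v b, place_norm Q_sqrt2 v c}" for v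
    \<comment> \<open>The units contribute exactly 1, and the integral element \<open>c\<close> at
      most 1.\<close>
    have fin: "m (Finite_Place P) = 1" if P: "P \<in> prime_ideals Q_sqrt2" for P
    proof -
      interpret zsqrt2_prime_ideal P using P by unfold_locales
      have "valuation Q_sqrt2 P a = 0" "valuation Q_sqrt2 P b = 0"
        using units O valuation_unit by blast+
      moreover have "real (abs_norm Q_sqrt2 P) powi (- valuation Q_sqrt2 P c) \<le> 1"
        using abs_norm_bounds(1) valuation_zsqrt2[OF O(3) ne(3)]
        by (simp add: power_int_minus inverse_le_1_iff)
      ultimately show ?thesis unfolding m_def by simp
    qed
    have inf1: "m (Infinite_Place {id_embedding}) \<ge> \<alpha> ^ n"
    proof -
      have "place_norm Q_sqrt2 (Infinite_Place {id_embedding}) a = \<alpha> ^ n"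
        using place_norm_infinite[of id_embedding a] cmod_quad_3_2[of n] a_pow
        by (simp add: embeddings_Q_sqrt2 a_def del: place_norm.simps)
      then show ?thesis unfolding m_def by (intro Max_ge) auto
    qed
    have inf2: "m (Infinite_Place {sqrt2_conj}) \<ge> \<alpha> ^ n"
    proof -
      have "sqrt2_conj b = - (quad 3 2 ^ n)"
        by (simp add: b_def power_quad B_def L_def quad_minus)
      then have "place_norm Q_sqrt2 (Infinite_Place {sqrt2_conj}) b = \<alpha> ^ n"
        using place_norm_infinite[of sqrt2_conj b] cmod_quad_3_2[of n]
        by (simp add: embeddings_Q_sqrt2 del: place_norm.simps)
      then show ?thesis unfolding m_def by (intro Max_ge) auto
    qed
    have V: "{v \<in> places Q_sqrt2. m v \<noteq> 1} = {Infinite_Place {id_embedding}, Infinite_Place {sqrt2_conj}}"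
      using fin inf1 inf2 alpha unfolding places_Q_sqrt2 by auto
    have "\<alpha> ^ (2 * n) = \<alpha> ^ n * \<alpha> ^ n" by (simp add: mult_2 power_add)
    also have "\<dots> \<le> m (Infinite_Place {id_embedding}) * m (Infinite_Place {sqrt2_conj})"
      using inf1 inf2 by (intro mult_mono) (auto intro: order_trans[of 0 "\<alpha> ^ n"])
    also have "\<dots> = (\<Prod>v\<in>{v \<in> places Q_sqrt2. m v \<noteq> 1}. m v)"
      unfolding V using id_embedding_neq_sqrt2_conj by simp
    also have "\<dots> = height Q_sqrt2 a b c"
      unfolding height_def Let_def m_def ..
    also have "\<dots> \<le> C * radical Q_sqrt2 a b c powr (1 + \<epsilon>)"
      using O ne zsqrt2_subset abc0 by (intro abcC) auto
    also have "\<dots> \<le> C * ((real (radical_of (2 * nat B)))\<^sup>2) powr (1 + \<epsilon>)"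
    proof -
      \<comment> \<open>A multiple of \<open>c\<close> that is a rational integer. Its prime factors
        divide 2 B_n, where the factor 2 covers the prime above 2 if B_n is odd.\<close>
      have cd: "c * complex_of_real (sqrt 2) = of_int (- 8 * B)"
      proof -
        have "complex_of_real (sqrt 2) = quad 0 1" by (simp add: quad_def)
        then have "c * complex_of_real (sqrt 2) = quad (of_int (- 8 * B)) 0"
          by (simp add: c_def quad_mult)
        then show ?thesis by (simp only: quad_rat of_rat_of_int_eq)
      qed
      have primes: "p dvd 2 * nat B" if "Factorial_Ring.prime p" "int p dvd - 8 * B" for p
      proof -
        have "int p dvd 2 ^ 2 * (2 * B)" using that(2) by simp
        then have "int p dvd 2 ^ 2 \<or> int p dvd 2 * B" using that(1) by (metis prime_dvd_mult_iff prime_int_nat_transfer prime_nat_int_transfer)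
        then have "int p dvd 2 * B"
        proof
          assume "int p dvd 2 ^ 2"
          moreover have "Factorial_Ring.prime (int p)" using that(1) by simp
          ultimately have "int p dvd 2" by (rule prime_dvd_power[rotated])
          then show ?thesis by (rule dvd_mult2)
        qed
        then have "int p dvd int (2 * nat B)" using B by simp
        then show ?thesis by (simp only: int_dvd_int_iff)
      qed
      show ?thesis
        using radical_le[OF O(3) ne(3) _ O(1) units(4,1) O(2) units(3,2) zsqrt2_sqrt_2 cd primes] B C \<epsilon>
        by (intro mult_left_mono powr_mono2) auto
    qed
    finally show "\<alpha> ^ (2 * n) \<le> C * ((real (radical_of (2 * nat (balancing n))))\<^sup>2) powr (1 + \<epsilon>)"
      unfolding B_def .
  qed
qed

section \<open>Counting\<close>

lemma radical_of_double:
  assumes "m > 0"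
  shows "radical_of (2 * m) \<le> 2 * radical_of m"
proof -
  have pf: "prime_factors (2 * m) = insert 2 (prime_factors m)"
    using assms by (simp add: prime_factors_product prime_factorization_prime)
  show ?thesis
  proof (cases "2 \<in> prime_factors m")
    case True
    then show ?thesis unfolding radical_of_def pf by (simp add: insert_absorb)
  next
    case False
    then show ?thesis unfolding radical_of_def pf by simp
  qed
qed

definition simple_primes :: "nat \<Rightarrow> nat set" where
  "simple_primes m = {p \<in> prime_factors m. \<not> p\<^sup>2 dvd m}"

text \<open>A prime of multiplicity at least 2 pays for its square within \<open>m\<close>; a simple
  prime needs one extra factor p. Hence a large radical forces a large product of simple
  primes.\<close>

lemma radical_of_squared_le:
  assumes "m > 0"
  shows "(radical_of m)\<^sup>2 \<le> \<Prod>(simple_primes m) * m"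
proof -
  have "(radical_of m)\<^sup>2 = (\<Prod>p\<in>prime_factors m. p\<^sup>2)"
    by (simp add: radical_of_def prod_power_distrib)
  also have "\<dots> \<le> (\<Prod>p\<in>prime_factors m. (if \<not> p\<^sup>2 dvd m then p else 1) * p ^ multiplicity p m)"
  proof (rule prod_mono)
    fix p assume p: "p \<in> prime_factors m"
    then have pr: "Factorial_Ring.prime p" and pm: "p dvd m" by auto
    have p1: "p > 1" using pr prime_gt_1_nat by blast
    have "p\<^sup>2 \<le> (if \<not> p\<^sup>2 dvd m then p else 1) * p ^ multiplicity p m"
    proof (cases "p\<^sup>2 dvd m")
      case True
      then have "2 \<le> multiplicity p m"
        using assms p1 by (intro multiplicity_geI) auto
      then have "p\<^sup>2 \<le> p ^ multiplicity p m" using p1 by (intro power_increasing) auto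
      then show ?thesis using True by simp
    next
      case False
      have "1 \<le> multiplicity p m"
        using assms p1 pm by (intro multiplicity_geI) auto
      then have "p ^ 1 \<le> p ^ multiplicity p m" using p1 by (intro power_increasing) auto
      then show ?thesis using False by (simp add: power2_eq_square)
    qed
    then show "0 \<le> p\<^sup>2 \<and> p\<^sup>2 \<le> (if \<not> p\<^sup>2 dvd m then p else 1) * p ^ multiplicity p m" by simp
  qed
  also have "\<dots> = (\<Prod>p\<in>prime_factors m. if \<not> p\<^sup>2 dvd m then p else 1) * (\<Prod>p\<in>prime_factors m. p ^ multiplicity p m)"
    by (rule prod.distrib)
  also have "(\<Prod>p\<in>prime_factors m. if \<not> p\<^sup>2 dvd m then p else 1) = \<Prod>(simple_primes m)"
    unfolding simple_primes_def by (rule prod.inter_filter[symmetric]) simp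
  also have "(\<Prod>p\<in>prime_factors m. p ^ multiplicity p m) = m"
    using assms prod_prime_factors[of m] by simp
  finally show ?thesis .
qed

lemma prod_primes_dvd:
  fixes N :: nat
  assumes "finite A" "\<And>p. p \<in> A \<Longrightarrow> Factorial_Ring.prime p \<and> p dvd N"
  shows "\<Prod>A dvd N"
  using assms
proof (induction A rule: finite_induct)
  case (insert p A)
  have "coprime p (\<Prod>A)"
  proof (rule prod_coprime_right)
    fix q assume "q \<in> A"
    then show "coprime p q" using insert by (intro primes_coprime) auto
  qed
  then show ?case using insert by (simp add: divides_mult)
qed auto

section \<open>Ranks that are new at a given index\<close>

text \<open>Write r^M k = d e. A common prime q of e and k would give d | n/q, so e is prime to k
  and k divides d. For a prime q | r the power q^M does not divide e, and this leaves enough factors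
  q for d.\<close>

lemma rank_structure:
  fixes d k r M :: nat
  assumes pos: "k > 0" "r > 0" "M > 0" and d: "d dvd r ^ M * k"
    and k: "\<And>q. q \<in> prime_factors k \<Longrightarrow> \<not> d dvd r ^ M * k div q"
    and r: "\<And>q. q \<in> prime_factors r \<Longrightarrow> \<not> d dvd r ^ M * k div q ^ M"
  shows "k dvd d" "r dvd d"
proof -
  define n where "n = r ^ M * k"
  have n: "n > 0" using pos by (simp add: n_def)
  obtain e where e: "n = d * e" using d unfolding n_def by blast
  have de: "d > 0" "e > 0" using n e by auto
  have "coprime e k"
  proof (rule ccontr)
    assume "\<not> coprime e k"
    then have "gcd e k \<noteq> 1" by (simp only: coprime_iff_gcd_eq_1 not_False_eq_True)
    then obtain q where "Factorial_Ring.prime q" "q dvd gcd e k" using prime_factor_nat by blast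
    then have q: "Factorial_Ring.prime q" "q dvd e" "q dvd k" by auto
    then obtain e' where "e = q * e'" by blast
    then have "n div q = d * e'" using e q(1) prime_gt_0_nat[of q] by (simp add: mult.left_commute)
    then have "d dvd n div q" by simp
    moreover have "q \<in> prime_factors k" using q pos by (simp add: in_prime_factors_iff)
    ultimately show False using k unfolding n_def by blast
  qed
  moreover have "k dvd d * e" using e[symmetric] by (simp add: n_def)
  ultimately show "k dvd d" by (simp add: coprime_dvd_mult_left_iff coprime_commute)
  show "r dvd d"
  proof (rule multiplicity_le_imp_dvd)
    fix q :: nat assume q: "Factorial_Ring.prime q"
    show "multiplicity q r \<le> multiplicity q d"
    proof (cases "q dvd r")
      case False
      then show ?thesis by (simp add: not_dvd_imp_multiplicity_0)
    next
      case True
      then have qr: "q \<in> prime_factors r" using q pos by (simp add: in_prime_factors_iff)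
      have pe: "prime_elem q" using q by simp
      have "M * multiplicity q r + multiplicity q k = multiplicity q d + multiplicity q e"
      proof -
        have "multiplicity q n = multiplicity q d + multiplicity q e"
          unfolding e using de by (intro prime_elem_multiplicity_mult_distrib[OF pe]) auto
        moreover have "multiplicity q n = M * multiplicity q r + multiplicity q k"
          unfolding n_def using pos
          by (simp add: prime_elem_multiplicity_mult_distrib[OF pe] prime_elem_multiplicity_power_distrib[OF pe])
        ultimately show ?thesis by simp
      qed
      moreover have "multiplicity q e < M"
      proof (rule ccontr)
        assume "\<not> multiplicity q e < M"
        then have "q ^ M dvd e" by (intro multiplicity_dvd') simp
        then obtain e' where "e = q ^ M * e'" by blast
        then have "n div q ^ M = d * e'" using e q prime_gt_0_nat[of q] by (simp add: mult.left_commute)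
        then have "d dvd n div q ^ M" by simp
        then show False using r[OF qr] unfolding n_def by blast
      qed
      moreover have "multiplicity q r \<ge> 1"
        using True pos q prime_gt_1_nat[of q] by (intro multiplicity_geI) auto
      \<comment> \<open>The multiplicity of \<open>q\<close> in \<open>d\<close> is at least M (v +
        1) - (M - 1) = M v + 1, hence at least v + 1.\<close>
      then obtain v where v: "multiplicity q r = Suc v" by (cases "multiplicity q r") auto
      moreover obtain M' where "M = Suc M'" using pos by (cases M) auto
      ultimately show ?thesis by simp
    qed
  qed (use pos in simp)
qed

section \<open>The density of suitable multipliers\<close>

text \<open>Multiplied by n, this is the exponent of \<alpha> that bounds the product of B(n/q) over
  the primes q | k.\<close>

definition inverse_prime_sum :: "nat \<Rightarrow> real" where
  "inverse_prime_sum k = (\<Sum>q\<in>prime_factors k. 1 / real q)"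

text \<open>The prime 2 contributes 1/4, and the odd primes are among the numbers 2 j + 1 with j at
  least 1, which contribute at most another 1/4.\<close>

lemma sum_inverse_prime_squares_le:
  "(\<Sum>q | Factorial_Ring.prime q \<and> q \<le> Y. 1 / (real q)\<^sup>2) \<le> 1 / 2"
proof -
  have sub: "{q. Factorial_Ring.prime q \<and> q \<le> Y} \<subseteq> insert 2 ((\<lambda>j. 2 * j + 1) ` {1..Y})"
  proof
    fix q assume "q \<in> {q. Factorial_Ring.prime q \<and> q \<le> Y}"
    then have q: "Factorial_Ring.prime q" "q \<le> Y" by auto
    show "q \<in> insert 2 ((\<lambda>j. 2 * j + 1) ` {1..Y})"
    proof (cases "even q")
      case True
      then have "q = 2" using q(1) by (metis primes_dvd_imp_eq two_is_prime_nat)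
      then show ?thesis by simp
    next
      case False
      then obtain j where j: "q = 2 * j + 1" by (auto elim: oddE)
      then have "j \<ge> 1" using prime_gt_1_nat[OF q(1)] by (cases j) auto
      then show ?thesis using j q(2) by auto
    qed
  qed
  \<comment> \<open>Telescoping, since (2 j + 1)^2 exceeds 4 j (j + 1).\<close>
  have tel: "(\<Sum>j=1..Y. 1 / (real (2 * j + 1))\<^sup>2) \<le> (1 - 1 / real (Y + 1)) / 4"
  proof (induction Y)
    case (Suc Y)
    have "1 / (real (2 * Suc Y + 1))\<^sup>2 \<le> 1 / (4 * (real Y + 1) * (real Y + 2))"
    proof (rule divide_left_mono)
      have "0 < (real (2 * Suc Y + 1))\<^sup>2" by simp
      then show "0 < (real (2 * Suc Y + 1))\<^sup>2 * (4 * (real Y + 1) * (real Y + 2))" by simp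
    qed (auto simp: power2_eq_square algebra_simps)
    also have "\<dots> = (1 / (real Y + 1) - 1 / (real Y + 2)) / 4"
      by (simp add: field_simps)
    finally show ?case using Suc by (simp add: add_ac)
  qed simp
  have "(\<Sum>q | Factorial_Ring.prime q \<and> q \<le> Y. 1 / (real q)\<^sup>2)
      \<le> (\<Sum>q\<in>insert 2 ((\<lambda>j. 2 * j + 1) ` {1..Y}). 1 / (real q)\<^sup>2)"
    using sub by (intro sum_mono2) auto
  also have "\<dots> = 1 / 4 + (\<Sum>q\<in>(\<lambda>j. 2 * j + 1) ` {1..Y}. 1 / (real q)\<^sup>2)"
  proof (subst sum.insert)
    show "2 \<notin> (\<lambda>j. 2 * j + 1) ` {1..Y}" by auto
  qed auto
  also have "(\<Sum>q\<in>(\<lambda>j. 2 * j + 1) ` {1..Y}. 1 / (real q)\<^sup>2) = (\<Sum>j=1..Y. 1 / (real (2 * j + 1))\<^sup>2)"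
    by (subst sum.reindex) (auto simp: inj_on_def)
  also have "1 / 4 + \<dots> \<le> 1 / 4 + (1 - 1 / real (Y + 1)) / 4" using tel by simp
  also have "\<dots> \<le> 1 / 4 + 1 / 4" by (intro add_left_mono divide_right_mono) auto
  finally show ?thesis by simp
qed

lemma card_multiples_le: "real (card {k \<in> {1..Y}. q dvd k}) \<le> real Y / real q"
\<comment> \<open>For \<open>q = 0\<close> both sides are 0: no positive number is a multiple of 0,
  and division by 0 yields 0.\<close>
proof (cases "q = 0")
  case False
  have "{k \<in> {1..Y}. q dvd k} \<subseteq> (\<lambda>j. q * j) ` {1..Y div q}"
  proof
    fix k assume k: "k \<in> {k \<in> {1..Y}. q dvd k}"
    then obtain j where j: "k = q * j" by blast
    have "q * j div q \<le> Y div q" using k j by (intro div_le_mono) auto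
    then show "k \<in> (\<lambda>j. q * j) ` {1..Y div q}" using k j False by auto
  qed
  then have "card {k \<in> {1..Y}. q dvd k} \<le> card ((\<lambda>j. q * j) ` {1..Y div q})"
    by (intro card_mono) auto
  also have "\<dots> \<le> Y div q" using card_image_le[of "{1..Y div q}" "\<lambda>j. q * j"] by simp
  finally have "real (card {k \<in> {1..Y}. q dvd k}) \<le> real (Y div q)" by simp
  also have "\<dots> \<le> real Y / real q"
  proof -
    have "real (Y div q * q) \<le> real Y" by (intro of_nat_mono) simp
    then show ?thesis using False by (simp add: field_simps)
  qed
  finally show ?thesis .
qed auto

text \<open>Interchanging sums, the total over k up to Y is at most Y times the sum of 1/q^2, hence
  at most Y/2. By Markov's inequality at most (Y/2)/(3/4) = 2 Y/3 of the k exceed 3/4.\<close>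

lemma card_small_inverse_prime_sum:
  "real (card {k \<in> {1..Y}. inverse_prime_sum k \<le> 3 / 4}) \<ge> real Y / 3"
proof -
  define Q where "Q = {q. Factorial_Ring.prime q \<and> q \<le> Y}"
  have finQ: "finite Q" unfolding Q_def by simp
  have nn: "inverse_prime_sum k \<ge> 0" for k
    unfolding inverse_prime_sum_def by (intro sum_nonneg) auto
  have "(\<Sum>k\<in>{1..Y}. inverse_prime_sum k) = (\<Sum>k\<in>{1..Y}. \<Sum>q\<in>Q. if q dvd k then 1 / real q else 0)"
  proof (rule sum.cong)
    fix k assume k: "k \<in> {1..Y}"
    have "prime_factors k = {q \<in> Q. q dvd k}"
    proof (intro equalityI subsetI)
      fix q assume "q \<in> prime_factors k"
      then have "Factorial_Ring.prime q" "q dvd k" by auto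
      moreover then have "q \<le> Y" using k dvd_imp_le[of q k] by auto
      ultimately show "q \<in> {q \<in> Q. q dvd k}" by (simp add: Q_def)
    qed (use k in \<open>auto simp: Q_def in_prime_factors_iff\<close>)
    then show "inverse_prime_sum k = (\<Sum>q\<in>Q. if q dvd k then 1 / real q else 0)"
      unfolding inverse_prime_sum_def using sum.inter_filter[OF finQ] by simp
  qed simp
  also have "\<dots> = (\<Sum>q\<in>Q. \<Sum>k\<in>{1..Y}. if q dvd k then 1 / real q else 0)"
    by (rule sum.swap)
  also have "\<dots> = (\<Sum>q\<in>Q. real (card {k \<in> {1..Y}. q dvd k}) * (1 / real q))"
    by (intro sum.cong) (simp_all flip: sum.inter_filter)
  also have "\<dots> \<le> (\<Sum>q\<in>Q. real Y / real q * (1 / real q))"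
    by (intro sum_mono mult_right_mono card_multiples_le) auto
  also have "\<dots> = real Y * (\<Sum>q\<in>Q. 1 / (real q)\<^sup>2)"
    by (simp add: sum_distrib_left power2_eq_square)
  also have "\<dots> \<le> real Y * (1 / 2)"
    unfolding Q_def by (intro mult_left_mono sum_inverse_prime_squares_le) auto
  finally have total: "(\<Sum>k\<in>{1..Y}. inverse_prime_sum k) \<le> real Y / 2" by simp
  define G where "G = {k \<in> {1..Y}. inverse_prime_sum k \<le> 3 / 4}"
  define H where "H = {k \<in> {1..Y}. \<not> inverse_prime_sum k \<le> 3 / 4}"
  have "real (card H) * (3 / 4) = (\<Sum>k\<in>H. 3 / 4)" by simp
  also have "\<dots> \<le> (\<Sum>k\<in>H. inverse_prime_sum k)"
    by (intro sum_mono) (auto simp: H_def)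
  also have "\<dots> \<le> (\<Sum>k\<in>{1..Y}. inverse_prime_sum k)"
    using nn by (intro sum_mono2) (auto simp: H_def)
  finally have "real (card H) \<le> 2 / 3 * real Y" using total by simp
  moreover have "card G + card H = Y"
  proof -
    have "card (G \<union> H) = card G + card H"
      by (rule card_Un_disjoint) (auto simp: G_def H_def)
    moreover have "G \<union> H = {1..Y}" by (auto simp: G_def H_def)
    ultimately show ?thesis by simp
  qed
  then have "real (card G) + real (card H) = real Y" by (simp flip: of_nat_add)
  ultimately show ?thesis unfolding G_def by linarith
qed

section \<open>Existence of a new simple prime\<close>

lemma alpha_gt_1: "\<alpha> > 1"
  using real_sqrt_ge_0_iff[of 8] by linarith

lemma balancing_div_le:
  assumes "q dvd n"
  shows "real (nat (balancing (n div q))) \<le> \<alpha> powr (real n / real q)"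
proof -
  have "real (nat (balancing (n div q))) \<le> \<alpha> ^ (n div q)"
    using balancing_le_power[of "n div q"] balancing_bounds[of "n div q"] by simp
  also have "\<dots> = \<alpha> powr real (n div q)"
    using alpha_gt_1 by (simp add: powr_realpow)
  also have "real (n div q) = real n / real q" using assms by (rule real_of_nat_div)
  finally show ?thesis .
qed

lemma prod_balancing_div_le:
  assumes "finite A" "\<And>q. q \<in> A \<Longrightarrow> f q dvd n"
  shows "real (\<Prod>q\<in>A. nat (balancing (n div f q))) \<le> \<alpha> powr (real n * (\<Sum>q\<in>A. 1 / real (f q)))"
proof -
  have "real (\<Prod>q\<in>A. nat (balancing (n div f q))) = (\<Prod>q\<in>A. real (nat (balancing (n div f q))))"
    by simp
  also have "\<dots> \<le> (\<Prod>q\<in>A. \<alpha> powr (real n / real (f q)))"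
    using assms(2) by (intro prod_mono) (auto intro: balancing_div_le)
  also have "\<dots> = \<alpha> powr (\<Sum>q\<in>A. real n / real (f q))"
    using alpha_gt_1 by (intro powr_sum[symmetric]) auto
  also have "(\<Sum>q\<in>A. real n / real (f q)) = real n * (\<Sum>q\<in>A. 1 / real (f q))"
    by (simp add: sum_distrib_left)
  finally show ?thesis .
qed

text \<open>There are at most r, hence at most 2^r, summands, each at most 2^(-(r+4)); this is the
  reason for the exponent r + 4.\<close>

lemma sum_inverse_prime_powers_le:
  assumes "r > 0"
  shows "(\<Sum>q\<in>prime_factors r. 1 / real (q ^ (r + 4))) \<le> 1 / 16"
proof -
  have "(\<Sum>q\<in>prime_factors r. 1 / real (q ^ (r + 4))) \<le> (\<Sum>q\<in>prime_factors r. 1 / 2 ^ (r + 4))"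
  proof (rule sum_mono)
    fix q assume "q \<in> prime_factors r"
    then have "2 \<le> q" by (auto intro: prime_ge_2_nat)
    then have "(2::real) ^ (r + 4) \<le> real q ^ (r + 4)" by (intro power_mono) auto
    then show "1 / real (q ^ (r + 4)) \<le> 1 / 2 ^ (r + 4)" using \<open>2 \<le> q\<close> by (simp add: frac_le)
  qed
  also have "\<dots> = real (card (prime_factors r)) / 2 ^ (r + 4)" by simp
  also have "\<dots> \<le> real r / 2 ^ (r + 4)"
  proof -
    have "prime_factors r \<subseteq> {1..r}"
      using assms by (auto simp: in_prime_factors_iff dvd_imp_le Suc_leI prime_gt_0_nat)
    then have "card (prime_factors r) \<le> card {1..r}" by (intro card_mono) auto
    then show ?thesis by (intro divide_right_mono) auto
  qed
  also have "\<dots> \<le> 2 ^ r / 2 ^ (r + 4)"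
    by (intro divide_right_mono) (auto intro!: less_imp_le)
  also have "\<dots> = 1 / 16" by (simp add: power_add)
  finally show ?thesis .
qed

text \<open>Otherwise every odd simple prime of B(n) divides \<open>U\<close> or \<open>V\<close>,
  so the simple primes have product at most 2 U V, and the squared radical of 2 B(n) has
  \<alpha>-exponent at most (1 + 3/4 + 1/16) n = 29 n/16.\<close>

lemma new_prime_exists:
  assumes abc: "abc_conjecture Q_sqrt2" and r: "r \<ge> (2::nat)"
  obtains n0 :: nat where
    "\<And>k n. k > 0 \<Longrightarrow> inverse_prime_sum k \<le> 3 / 4 \<Longrightarrow> n = r ^ (r + 4) * k \<Longrightarrow> n \<ge> n0 \<Longrightarrow>
      \<exists>p. Factorial_Ring.prime p \<and> odd p \<and> int p dvd balancing n \<and> \<not> (int p)\<^sup>2 dvd balancing n \<and>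
        (\<forall>q\<in>prime_factors k. \<not> int p dvd balancing (n div q)) \<and>
        (\<forall>q\<in>prime_factors r. \<not> int p dvd balancing (n div q ^ (r + 4)))"
proof -
  define M where "M = r + 4"
  \<comment> \<open>The choice 1/10 is small enough: (29/16)(11/10) = 319/160 is still below
    2.\<close>
  have "(1 / 10 :: real) > 0" by simp
  then obtain C where C: "C > 0" and le:
    "\<And>n. n > 0 \<Longrightarrow> \<alpha> ^ (2 * n) \<le> C * ((real (radical_of (2 * nat (balancing n))))\<^sup>2) powr (1 + 1 / 10)"
    using abc_balancing[OF abc, of "1 / 10"] by blast
  \<comment> \<open>The 8 collects a 4 from doubling inside the squared radical and the 2 in
    \<open>N\<close>.\<close>
  define D where "D = C * 8 powr (11 / 10)"
  have D: "D > 0" using C by (simp add: D_def)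
  \<comment> \<open>The abc inequality will bound n (2 - 319/160) ln \<alpha> by ln D, and the
    difference is 1/160.\<close>
  obtain n0 :: nat where n0: "real n0 > 160 * (ln D / ln \<alpha>)" using reals_Archimedean2 by blast
  have lna: "ln \<alpha> > 0" using alpha_gt_1 by simp
  show ?thesis
  proof (rule that[of n0], rule ccontr)
    fix k n :: nat
    assume k: "k > 0" "inverse_prime_sum k \<le> 3 / 4" and n: "n = r ^ (r + 4) * k" "n \<ge> n0"
    assume no: "\<not> (\<exists>p. Factorial_Ring.prime p \<and> odd p \<and> int p dvd balancing n \<and> \<not> (int p)\<^sup>2 dvd balancing n \<and>
        (\<forall>q\<in>prime_factors k. \<not> int p dvd balancing (n div q)) \<and>
        (\<forall>q\<in>prime_factors r. \<not> int p dvd balancing (n div q ^ (r + 4))))"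
    have npos: "n > 0" using n k r by simp
    have kdvd: "q dvd n" if "q \<in> prime_factors k" for q using that n by auto
    have rdvd: "q ^ M dvd n" if "q \<in> prime_factors r" for q
      using that unfolding n M_def[symmetric] by (intro dvd_mult2 dvd_power_same) auto
    have divpos: "balancing (n div q) > 0" if "q dvd n" for q
      using that npos by (intro balancing_pos) (auto elim: dvdE)
    define b where "b = nat (balancing n)"
    have b: "b > 0" "int b = balancing n" using balancing_pos[OF npos] by (auto simp: b_def)
    define U V where "U = (\<Prod>q\<in>prime_factors k. nat (balancing (n div q)))"
      and "V = (\<Prod>q\<in>prime_factors r. nat (balancing (n div q ^ M)))"
    have UV: "U > 0" "V > 0" unfolding U_def V_def using kdvd rdvd divpos by (auto intro!: prod_pos)
    \<comment> \<open>The factor 2 takes care of the prime 2, which may be simple without being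
      old.\<close>
    define N where "N = 2 * (U * V)"
    have "\<Prod>(simple_primes b) dvd N"
    proof (rule prod_primes_dvd)
      show "finite (simple_primes b)" by (simp add: simple_primes_def)
      fix p assume p: "p \<in> simple_primes b"
      then have pr: "Factorial_Ring.prime p" and "p dvd b" "\<not> p\<^sup>2 dvd b"
        unfolding simple_primes_def by auto
      then have pb: "int p dvd balancing n" "\<not> (int p)\<^sup>2 dvd balancing n"
        unfolding b(2)[symmetric] by (auto simp flip: of_nat_power)
      have dvd_nat: "p dvd nat (balancing m)" if "int p dvd balancing m" for m
        using that balancing_bounds[of m] by (simp add: nat_dvd_iff dvd_nat_abs_iff int_dvd_int_iff[symmetric])
      have "p dvd N"
      proof (cases "odd p")
        case False
        then have "p = 2" using pr by (metis primes_dvd_imp_eq two_is_prime_nat)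
        then show ?thesis unfolding N_def by simp
      next
        case True
        then have "(\<exists>q\<in>prime_factors k. int p dvd balancing (n div q)) \<or>
          (\<exists>q\<in>prime_factors r. int p dvd balancing (n div q ^ M))"
          using no pr pb unfolding M_def by blast
        then have "p dvd U \<or> p dvd V"
        proof
          assume "\<exists>q\<in>prime_factors k. int p dvd balancing (n div q)"
          then obtain q where "q \<in> prime_factors k" "p dvd nat (balancing (n div q))"
            using dvd_nat by blast
          then have "p dvd U"
            unfolding U_def by (meson dvd_prodI dvd_trans finite_set_mset)
          then show ?thesis ..
        next
          assume "\<exists>q\<in>prime_factors r. int p dvd balancing (n div q ^ M)"
          then obtain q where "q \<in> prime_factors r" "p dvd nat (balancing (n div q ^ M))"
            using dvd_nat by blast
          then have "p dvd V"
            unfolding V_def by (meson dvd_prodI dvd_trans finite_set_mset)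
          then show ?thesis ..
        qed
        then show ?thesis unfolding N_def by auto
      qed
      then show "Factorial_Ring.prime p \<and> p dvd N" using pr by simp
    qed
    then have "\<Prod>(simple_primes b) \<le> N" using UV by (intro dvd_imp_le) (auto simp: N_def)
    have "real U \<le> \<alpha> powr (real n * (\<Sum>q\<in>prime_factors k. 1 / real q))"
      unfolding U_def using kdvd by (intro prod_balancing_div_le) auto
    also have "\<dots> \<le> \<alpha> powr (real n * (3 / 4))"
      using k(2) alpha_gt_1 unfolding inverse_prime_sum_def by (intro powr_mono mult_left_mono) auto
    finally have U: "real U \<le> \<alpha> powr (real n * (3 / 4))" .
    have "real V \<le> \<alpha> powr (real n * (\<Sum>q\<in>prime_factors r. 1 / real (q ^ M)))"
      unfolding V_def using rdvd by (intro prod_balancing_div_le) auto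
    also have "\<dots> \<le> \<alpha> powr (real n * (1 / 16))"
      using sum_inverse_prime_powers_le[of r] r alpha_gt_1 unfolding M_def
      by (intro powr_mono mult_left_mono) auto
    finally have V: "real V \<le> \<alpha> powr (real n * (1 / 16))" .
    have "real N \<le> 2 * (\<alpha> powr (real n * (3 / 4)) * \<alpha> powr (real n * (1 / 16)))"
      unfolding N_def using U V by (simp add: mult_mono)
    also have "\<dots> = 2 * \<alpha> powr (real n * (13 / 16))"
      by (simp flip: powr_add) (simp add: field_simps)
    finally have N: "real N \<le> 2 * \<alpha> powr (real n * (13 / 16))" .
    have bn: "real b \<le> \<alpha> powr real n"
    proof -
      have "real b = real_of_int (balancing n)" using b(2) by (metis of_int_of_nat_eq)
      then show ?thesis using balancing_le_power[of n] alpha_gt_1 by (simp add: powr_realpow)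
    qed
    have "real ((radical_of (2 * b))\<^sup>2) \<le> real ((2 * radical_of b)\<^sup>2)"
      using radical_of_double[OF b(1)] by (intro of_nat_mono power_mono) auto
    also have "\<dots> \<le> real (4 * (\<Prod>(simple_primes b) * b))"
      using radical_of_squared_le[OF b(1)] by (intro of_nat_mono) (simp add: power_mult_distrib)
    also have "\<dots> \<le> real (4 * (N * b))"
      using \<open>\<Prod>(simple_primes b) \<le> N\<close> by (intro of_nat_mono mult_left_mono mult_right_mono) auto
    also have "\<dots> = 4 * (real N * real b)" by simp
    also have "\<dots> \<le> 4 * ((2 * \<alpha> powr (real n * (13 / 16))) * \<alpha> powr real n)"
      using N bn by (intro mult_left_mono mult_mono) auto
    also have "\<dots> = 8 * \<alpha> powr (real n * (29 / 16))"
      by (simp flip: powr_add) (simp add: field_simps)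
    finally have rad: "(real (radical_of (2 * b)))\<^sup>2 \<le> 8 * \<alpha> powr (real n * (29 / 16))" by simp
    have "\<alpha> powr (2 * real n) = \<alpha> ^ (2 * n)"
      using alpha_gt_1 by (simp add: powr_realpow[symmetric])
    also have "\<dots> \<le> C * ((real (radical_of (2 * b)))\<^sup>2) powr (11 / 10)"
      using le[OF npos] by (simp add: b_def)
    also have "\<dots> \<le> C * (8 * \<alpha> powr (real n * (29 / 16))) powr (11 / 10)"
      using rad C by (intro mult_left_mono powr_mono2) auto
    also have "\<dots> = D * \<alpha> powr (real n * (319 / 160))"
    proof -
      have "real n * (29 / 16) * (11 / 10) = real n * (319 / 160)" by simp
      then show ?thesis unfolding D_def powr_mult powr_powr by (simp only: mult.assoc)
    qed
    finally have "\<alpha> powr (2 * real n) \<le> D * \<alpha> powr (real n * (319 / 160))" .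
    then have "ln (\<alpha> powr (2 * real n)) \<le> ln (D * \<alpha> powr (real n * (319 / 160)))"
      using alpha_gt_1 by (intro ln_mono) auto
    also have "\<dots> = ln D + real n * (319 / 160) * ln \<alpha>"
      using D alpha_gt_1 by (simp add: ln_mult ln_powr)
    finally have "2 * real n * ln \<alpha> \<le> ln D + real n * (319 / 160) * ln \<alpha>"
      using alpha_gt_1 by (simp add: ln_powr)
    then have "real n * ln \<alpha> \<le> 160 * ln D" by argo
    then have "real n \<le> 160 * ln D / ln \<alpha>" using lna by (subst pos_le_divide_eq)
    then have "real n \<le> 160 * (ln D / ln \<alpha>)" by argo
    then show False using n0 n(2) by simp
  qed
qed

section \<open>Counting the primes produced\<close>

lemma card_le_fibres:
  assumes "finite A" "\<And>y. y \<in> f ` A \<Longrightarrow> card {x \<in> A. f x = y} \<le> m"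
  shows "card A \<le> m * card (f ` A)"
proof -
  have "card A = (\<Sum>x\<in>A. 1)" by simp
  also have "\<dots> = (\<Sum>y\<in>f ` A. \<Sum>x | x \<in> A \<and> f x = y. 1)"
    by (rule sum.image_gen[OF assms(1)])
  also have "\<dots> \<le> (\<Sum>y\<in>f ` A. m)" using assms(2) by (intro sum_mono) simp
  finally show ?thesis by (simp add: mult.commute)
qed

theorem theorem1p1:
  fixes r :: int
  assumes "r \<ge> 2"
    and "abc_conjecture Q_sqrt2"
  shows "\<exists>c::real. c > 0 \<and> (\<exists>x0::real. \<forall>x\<ge>x0.
           c * ln x \<le> real (card {p::nat. real p \<le> x \<and>
             ([int p = 1] (mod r) \<or> [int p = -1] (mod r)) \<and> balancing_non_wieferich p}))"
proof -
  define r' where "r' = nat r"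
  have r': "r' \<ge> 2" "r = int r'" using assms(1) by (auto simp: r'_def)
  define M where "M = r' + 4"
  define R where "R = r' ^ M"
  have R: "R > 0" using r' by (simp add: R_def)
  obtain n0 where new: "\<And>k n. k > 0 \<Longrightarrow> inverse_prime_sum k \<le> 3 / 4 \<Longrightarrow> n = R * k \<Longrightarrow> n \<ge> n0 \<Longrightarrow>
      \<exists>p. Factorial_Ring.prime p \<and> odd p \<and> int p dvd balancing n \<and> \<not> (int p)\<^sup>2 dvd balancing n \<and>
        (\<forall>q\<in>prime_factors k. \<not> int p dvd balancing (n div q)) \<and>
        (\<forall>q\<in>prime_factors r'. \<not> int p dvd balancing (n div q ^ M))"
    using new_prime_exists[OF assms(2) r'(1)] unfolding R_def M_def by metis
  define good where "good k \<longleftrightarrow> k \<ge> n0 \<and> k > 0 \<and> inverse_prime_sum k \<le> 3 / 4" for k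
  define target where "target p \<longleftrightarrow> ([int p = 1] (mod r) \<or> [int p = -1] (mod r)) \<and> balancing_non_wieferich p" for p
  have "\<exists>p. target p \<and> real p \<le> \<alpha> ^ (R * k) \<and> k dvd apparition_rank (int p) \<and> apparition_rank (int p) dvd R * k"
    if good_k: "good k" for k
  proof -
    define n where "n = R * k"
    have k: "k > 0" using good_k by (simp add: good_def)
    have n: "n > 0" using k R by (simp add: n_def)
    have "k \<le> R * k" using R by simp
    then have "n \<ge> n0" using good_k by (simp add: good_def n_def le_trans[of n0 k])
    then obtain p where p: "Factorial_Ring.prime p" "odd p"
      and pn: "int p dvd balancing n" "\<not> (int p)\<^sup>2 dvd balancing n"
      and pk: "\<And>q. q \<in> prime_factors k \<Longrightarrow> \<not> int p dvd balancing (n div q)"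
      and pr: "\<And>q. q \<in> prime_factors r' \<Longrightarrow> \<not> int p dvd balancing (n div q ^ M)"
    proof -
      have "inverse_prime_sum k \<le> 3 / 4" using good_k by (simp add: good_def)
      from new[OF k this n_def \<open>n \<ge> n0\<close>] show ?thesis by (elim exE conjE) (rule that; blast)
    qed
    define d where "d = apparition_rank (int p)"
    have d: "int p dvd balancing m \<longleftrightarrow> d dvd m" for m
      unfolding d_def by (rule dvd_balancing_iff_rank_dvd[OF pn(1) n])
    have "k dvd d \<and> r' dvd d"
      using rank_structure[of k r' M d] k r' pn(1) pk pr
      unfolding d n_def R_def by (auto simp: M_def)
    moreover have "d dvd R * k" using pn(1) unfolding d n_def .
    moreover have "target p"
      unfolding target_def r'(2) using prime_cong_if_dvd_rank[OF p n pn(1), of "int r'"]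
        non_wieferich_if_exactly_divides[OF p n pn] \<open>k dvd d \<and> r' dvd d\<close> by (simp add: d_def)
    moreover have "real p \<le> \<alpha> ^ n"
    proof -
      have "int p \<le> balancing n" using pn(1) balancing_pos[OF n] by (rule zdvd_imp_le)
      then have "real p \<le> real_of_int (balancing n)" by linarith
      also have "\<dots> \<le> \<alpha> ^ n" by (rule balancing_le_power)
      finally show ?thesis .
    qed
    ultimately show ?thesis unfolding d_def n_def by blast
  qed
  then obtain f where f: "\<And>k. good k \<Longrightarrow> target (f k)" "\<And>k. good k \<Longrightarrow> real (f k) \<le> \<alpha> ^ (R * k)"
      "\<And>k. good k \<Longrightarrow> k dvd apparition_rank (int (f k))" "\<And>k. good k \<Longrightarrow> apparition_rank (int (f k)) dvd R * k"
    by metis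
  define A where "A = real R * ln \<alpha>"
  have A: "A > 0" using R alpha_gt_1 by (simp add: A_def)
  \<comment> \<open>\<open>A\<close> converts ln x into the range Y of k, R bounds the number of k
    sharing a prime, and 1/6 is half of the density 1/3, the other half paying for small k and
    rounding.\<close>
  define c where "c = 1 / (6 * real R * A)"
  have c: "c > 0" using R A by (simp add: c_def)
  \<comment> \<open>Beyond this point ln x / A is at least 2 + 6 n0, so (ln x / A - 1)/3 - n0 is at
    least (ln x / A)/6.\<close>
  define x0 where "x0 = max 1 (exp (A * (2 + 6 * real n0)))"
  have "c * ln x \<le> real (card {p::nat. real p \<le> x \<and> target p})" if x: "x \<ge> x0" for x
  proof -
    have x1: "x \<ge> 1" and xe: "x \<ge> exp (A * (2 + 6 * real n0))" using x by (auto simp: x0_def)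
    have "ln (exp (A * (2 + 6 * real n0))) \<le> ln x" using xe x1 by (intro ln_mono) auto
    then have lnx: "A * (2 + 6 * real n0) \<le> ln x" by simp
    \<comment> \<open>The largest Y for which \<alpha> to the power R Y does not exceed x.\<close>
    define Y where "Y = nat \<lfloor>ln x / A\<rfloor>"
    have lnxA: "ln x / A \<ge> 0" using x1 A by simp
    have Y: "real Y \<le> ln x / A" "real Y \<ge> ln x / A - 1" using lnxA unfolding Y_def by linarith+
    define G where "G = {k \<in> {1..Y}. good k}"
    have finG: "finite G" by (simp add: G_def)
    have "{k \<in> {1..Y}. inverse_prime_sum k \<le> 3 / 4} \<subseteq> G \<union> {..<n0}"
      by (auto simp: G_def good_def)
    then have "card {k \<in> {1..Y}. inverse_prime_sum k \<le> 3 / 4} \<le> card (G \<union> {..<n0})"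
      using finG by (intro card_mono) auto
    also have "\<dots> \<le> card G + n0" using card_Un_le[of G "{..<n0}"] by simp
    finally have "real (card {k \<in> {1..Y}. inverse_prime_sum k \<le> 3 / 4}) \<le> real (card G) + real n0" by linarith
    then have cardG: "real Y / 3 \<le> real (card G) + real n0"
      using card_small_inverse_prime_sum[of Y] by linarith
    have "card G \<le> R * card (f ` G)"
    proof (rule card_le_fibres[OF finG])
      fix p assume "p \<in> f ` G"
      define d where "d = apparition_rank (int p)"
      have "d > 0" if "good k" "f k = p" for k
      proof -
        have "d dvd R * k" using f(4)[OF that(1)] that(2) by (simp add: d_def)
        then show ?thesis using that(1) R by (cases d) (auto simp: good_def)
      qed
      moreover obtain k where "good k" "f k = p" using \<open>p \<in> f ` G\<close> by (auto simp: G_def)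
      ultimately have d: "d > 0" by blast
      \<comment> \<open>The prime determines its rank d; since k | d | R k, the quotient t = d / k
        divides R, and it recovers k as d / t. So at most R values of k share the prime.\<close>
      have kt: "\<exists>t\<in>{1..R}. d = k * t" if kp: "k \<in> G" "f k = p" for k
      proof -
        have k: "good k" "k > 0" using kp by (auto simp: G_def good_def)
        obtain t where t: "d = k * t" using f(3)[OF k(1)] kp(2) by (auto simp: d_def)
        have "k * t dvd k * R" using f(4)[OF k(1)] kp(2) t by (simp add: d_def mult.commute)
        then have "t dvd R" using k(2) by simp
        then show ?thesis using t d R by (auto intro!: bexI[of _ t] dvd_imp_le simp: Suc_leI)
      qed
      have "{k \<in> G. f k = p} \<subseteq> (\<lambda>t. d div t) ` {1..R}"
      proof
        fix k assume "k \<in> {k \<in> G. f k = p}"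
        then have "k \<in> G" "f k = p" by auto
        from kt[OF this] obtain t where "t \<in> {1..R}" "d = k * t" by blast
        then show "k \<in> (\<lambda>t. d div t) ` {1..R}" by (intro image_eqI[of _ _ t]) auto
      qed
      then have "card {k \<in> G. f k = p} \<le> card ((\<lambda>t. d div t) ` {1..R})" by (intro card_mono) auto
      also have "\<dots> \<le> R" using card_image_le[of "{1..R}" "\<lambda>t. d div t"] by simp
      finally show "card {k \<in> G. f k = p} \<le> R" .
    qed
    moreover have "card (f ` G) \<le> card {p::nat. real p \<le> x \<and> target p}"
    proof (rule card_mono)
      have "{p::nat. real p \<le> x \<and> target p} \<subseteq> {..nat \<lfloor>x\<rfloor>}" by (auto simp: le_nat_floor)
      then show "finite {p::nat. real p \<le> x \<and> target p}" by (rule finite_subset) simp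
      show "f ` G \<subseteq> {p::nat. real p \<le> x \<and> target p}"
      proof
        fix p assume "p \<in> f ` G"
        then obtain k where k: "k \<in> G" "p = f k" by blast
        then have gk: "good k" "k \<le> Y" by (auto simp: G_def)
        have "real p \<le> \<alpha> ^ (R * k)" using f(2)[OF gk(1)] k by simp
        also have "\<dots> \<le> \<alpha> ^ (R * Y)" using gk alpha_gt_1 by (intro power_increasing) auto
        also have "\<dots> = exp (real Y * A)"
          using alpha_gt_1 by (simp add: A_def exp_of_nat_mult[symmetric] flip: powr_realpow) (simp add: powr_def mult_ac)
        also have "\<dots> \<le> exp (ln x)" using Y(1) A by (simp add: field_simps)
        also have "\<dots> = x" using x1 by simp
        finally show "p \<in> {p. real p \<le> x \<and> target p}" using f(1)[OF gk(1)] k by simp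
      qed
    qed
    ultimately have "card G \<le> R * card {p::nat. real p \<le> x \<and> target p}"
      by (meson le_trans mult_le_mono2)
    then have "real (card G) \<le> real R * real (card {p::nat. real p \<le> x \<and> target p})"
      by (metis of_nat_le_iff of_nat_mult)
    moreover have "ln x / A / 6 \<le> real (card G)"
    proof -
      have "2 + 6 * real n0 \<le> ln x / A" using lnx A by (simp add: field_simps)
      then show ?thesis using cardG Y(2) by argo
    qed
    ultimately have "ln x / A / 6 \<le> real R * real (card {p::nat. real p \<le> x \<and> target p})" by linarith
    then show ?thesis using R A by (simp add: c_def field_simps)
  qed
  then show ?thesis using c unfolding target_def by blast
qed

end
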